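(* Let $\rho>0$, $\beta>0$, $x_0>0$, and let $x_{i+1}=a_ix_i+b_i$ be the linear stochastic recursion described in the context. For fixed positive integer $q$, assume that $\mathbb{E}[b_0^q]<\infty$. Then $$\lim_{n\to\infty}\frac1n\log\mathbb{E}[(x_n)^q]=\lambda(\rho,\beta;q),$$ where the limit is taken with $\beta=\frac12\sigma^2\tau n^2$ held fixed.
   Context: Setup: for each $n\ge1$ the parameters $\sigma=\sigma_n>0$ and $\tau=\tau_n>0$ satisfy $\frac12\sigma_n^2\tau_n n^2=\beta$, with $\beta$ fixed. $W(t)$ is a standard Brownian motion started at $0$ at time $0$, $t_i=i\tau$, $W_i=W(t_i)$, and $a_i=1+\rho e^{\sigma W_i-\frac12\sigma^2t_i}$. The $b_i$, $i\ge0$, are i.i.d. positive random variables independent of $(a_i)_{i\ge0}$. The process is $x_{i+1}=a_ix_i+b_i$ with deterministic initial value $x_0>0$, and $x_n$ is computed with parameters $\sigma_n,\tau_n$. The number $\lambda(\rho,\beta;q)$ is the Lyapunov exponent of the homogeneous recursion (the case $b_i\equiv0$): $\lambda(\rho,\beta;q)=\lim_{n\to\infty}\frac1n\log\mathbb{E}\big[\big(x_0\prod_{i=0}^{n-1}a_i\big)^q\big]$ under the same scaling; this limit exists and equals $$\sup_{g\in\mathcal{G}_q}\left\{g(1)\log\rho+\beta\int_0^1(g(1)-g(x))^2\,dx-q\int_0^1 I(g'(x)/q)\,dx\right\},$$ with $I(x)=x\log x+(1-x)\log(1-x)$ ($0\log0=0$) and $\mathcal{G}_q$ the set of absolutely continuous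 $g:[0,1]\to[0,q]$ with $g(0)=0$ and $0\le g'\le q$ almost everywhere. *)

theory Defs
  imports "HOL-Probability.Probability"
begin

definition brownian_motion :: "'a measure \<Rightarrow> (real \<Rightarrow> 'a \<Rightarrow> real) \<Rightarrow> bool" where
  "brownian_motion M W \<longleftrightarrow>
     prob_space M \<and>
     (\<forall>t\<ge>0. W t \<in> borel_measurable M) \<and>
     (AE \<omega> in M. W 0 \<omega> = 0) \<and>
     (\<forall>(k::nat) ts. 0 \<le> ts 0 \<and> mono_on {..k} ts \<longrightarrow>
        prob_space.indep_vars M (\<lambda>_. borel) (\<lambda>i \<omega>. W (ts (Suc i)) \<omega> - W (ts i) \<omega>) {..<k}) \<and>
     (\<forall>s t. 0 \<le> s \<and> s < t \<longrightarrow>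
        distributed M lborel (\<lambda>\<omega>. W t \<omega> - W s \<omega>) (normal_density 0 (sqrt (t - s)))) \<and>
     (AE \<omega> in M. continuous_on {0..} (\<lambda>t. W t \<omega>))"

definition mult_coeff :: "(real \<Rightarrow> 'a \<Rightarrow> real) \<Rightarrow> real \<Rightarrow> real \<Rightarrow> real \<Rightarrow> nat \<Rightarrow> 'a \<Rightarrow> real" where
  "mult_coeff W \<rho> \<sigma> \<tau> i \<omega> =
     1 + \<rho> * exp (\<sigma> * W (real i * \<tau>) \<omega> - 1/2 * \<sigma>\<^sup>2 * (real i * \<tau>))"

primrec lin_rec :: "(nat \<Rightarrow> real) \<Rightarrow> (nat \<Rightarrow> real) \<Rightarrow> real \<Rightarrow> nat \<Rightarrow> real" where
  "lin_rec a b x0 0 = x0"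
| "lin_rec a b x0 (Suc i) = a i * lin_rec a b x0 i + b i"

definition log_moment_rate ::
  "'a measure \<Rightarrow> (real \<Rightarrow> 'a \<Rightarrow> real) \<Rightarrow> (nat \<Rightarrow> 'a \<Rightarrow> real) \<Rightarrow> (nat \<Rightarrow> real) \<Rightarrow> (nat \<Rightarrow> real) \<Rightarrow>
   real \<Rightarrow> real \<Rightarrow> nat \<Rightarrow> nat \<Rightarrow> real" where
  "log_moment_rate M W b \<sigma> \<tau> \<rho> x0 q n =
     1 / real n * ln (\<integral>\<omega>. lin_rec (\<lambda>i. mult_coeff W \<rho> (\<sigma> n) (\<tau> n) i \<omega>) (\<lambda>i. b i \<omega>) x0 n ^ q \<partial>M)"

definition hom_log_moment_rate ::
  "'a measure \<Rightarrow> (real \<Rightarrow> 'a \<Rightarrow> real) \<Rightarrow> (nat \<Rightarrow> real) \<Rightarrow> (nat \<Rightarrow> real) \<Rightarrow>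
   real \<Rightarrow> real \<Rightarrow> nat \<Rightarrow> nat \<Rightarrow> real" where
  "hom_log_moment_rate M W \<sigma> \<tau> \<rho> x0 q n =
     1 / real n * ln (\<integral>\<omega>. (x0 * (\<Prod>i<n. mult_coeff W \<rho> (\<sigma> n) (\<tau> n) i \<omega>)) ^ q \<partial>M)"

text \<open>\<^const>\<open>lim\<close> is unspecified for divergent sequences, so a result about the following
  number should also establish convergence. That the number depends only on \<open>\<rho>\<close>,
  \<open>\<beta> = \<sigma>\<^sup>2 \<tau> n\<^sup>2 / 2\<close> and \<open>q\<close> is part of its variational characterization.\<close>

definition lyapunov_exponent ::
  "'a measure \<Rightarrow> (real \<Rightarrow> 'a \<Rightarrow> real) \<Rightarrow> (nat \<Rightarrow> real) \<Rightarrow> (nat \<Rightarrow> real) \<Rightarrow>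
   real \<Rightarrow> real \<Rightarrow> nat \<Rightarrow> real" where
  "lyapunov_exponent M W \<sigma> \<tau> \<rho> x0 q = lim (hom_log_moment_rate M W \<sigma> \<tau> \<rho> x0 q)"

text \<open>Absolute continuity of a function on \<open>[l, r]\<close>; a pair \<open>(u, v)\<close> stands for the interval
  with these end points. (The library's \<^const>\<open>absolutely_continuous\<close> is about measures.)\<close>

definition abs_continuous_on_Icc :: "real \<Rightarrow> real \<Rightarrow> (real \<Rightarrow> real) \<Rightarrow> bool" where
  "abs_continuous_on_Icc l r g \<longleftrightarrow>
     (\<forall>\<epsilon>>0. \<exists>\<delta>>0. \<forall>D. finite D \<and> (\<forall>(u, v)\<in>D. l \<le> u \<and> u \<le> v \<and> v \<le> r) \<and>
        pairwise (\<lambda>(u, v) (u', v'). {u<..<v} \<inter> {u'<..<v'} = {}) D \<and>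
        (\<Sum>(u, v)\<in>D. v - u) < \<delta> \<longrightarrow> (\<Sum>(u, v)\<in>D. \<bar>g v - g u\<bar>) < \<epsilon>)"

text \<open>Since \<^term>\<open>ln (0::real) = 0\<close>, the convention \<open>0 log 0 = 0\<close> holds automatically.\<close>

definition I_fun :: "real \<Rightarrow> real" where
  "I_fun x = x * ln x + (1 - x) * ln (1 - x)"

text \<open>Only the values of \<open>g\<close> on \<open>[0, 1]\<close> are constrained; \<^term>\<open>deriv g\<close> at interior points
  depends on these values only.\<close>

definition admissible :: "nat \<Rightarrow> (real \<Rightarrow> real) set" where
  "admissible q = {g. g \<in> {0..1} \<rightarrow> {0..real q} \<and> abs_continuous_on_Icc 0 1 g \<and> g 0 = 0 \<and>
     (AE x in lborel. x \<in> {0..1} \<longrightarrow>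
        g differentiable (at x) \<and> 0 \<le> deriv g x \<and> deriv g x \<le> real q)}"

definition variational_value :: "real \<Rightarrow> real \<Rightarrow> nat \<Rightarrow> real" where
  "variational_value \<rho> \<beta> q =
     (SUP g\<in>admissible q.
        g 1 * ln \<rho> + \<beta> * integral {0..1} (\<lambda>x. (g 1 - g x)\<^sup>2)
        - real q * integral {0..1} (\<lambda>x. I_fun (deriv g x / real q)))"

end

theory Submission
  imports Defs "HOL-Real_Asymp.Real_Asymp"
begin

text \<open>Write \<open>Z n\<close> for the expectation of \<open>(\<Prod>i<n. a i) ^ q\<close>. Expanding each \<open>a i ^ q\<close> by the binomial
theorem and taking Gaussian moments (\<open>moment_prod_mult_coeff\<close>) shows that
\<open>Z n = (\<Sum>k. (\<Prod>i<n. (q choose k i) * \<rho> ^ k i) * exp (\<beta> / n\<^sup>2 * (\<Sum>j. T j ^ 2 - T j)))\<close>, where \<open>k\<close> runs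
through all maps from \<open>{..<n}\<close> to \<open>{..q}\<close>, \<open>j\<close> through \<open>{1..<n}\<close>, and \<open>T j = (\<Sum>i\<in>{j..<n}. k i)\<close>. This is the partition
function of a lattice gas with mean-field interaction. On the macroscopic scale the path
\<open>g (j / n) = (\<Sum>i<j. k i) / n\<close> describes a configuration: \<open>T j = n * (g 1 - g (j / n))\<close>, the
interaction becomes \<open>\<beta> * \<integral>(g 1 - g x)\<^sup>2\<close> per site, and there are about
\<open>exp (- n * q * \<integral>I(g' / q))\<close> configurations, counted with binomial weights, near \<open>g\<close>. Hence
\<open>ln (Z n) / n\<close> tends to the supremum of the variational functional, which is proved by two
inequalities for finite \<open>n\<close>.

\<^item> Lower bound (\<open>partition_sum_ge\<close>, \<open>rate_functional_le\<close>). The energy is convex. Replacing it by its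
  tangent at the tail profile of a given \<open>g\<close> makes the sum factorise into
  \<open>\<Prod>i. (1 + exp (\<theta> i)) ^ q\<close>, and the inequality \<open>\<theta> y - I(y) \<le> ln (1 + exp \<theta>)\<close>, integrated with
  \<open>y = g' / q\<close>, recovers the entropy. So \<open>ln (Z n) / n\<close> is at least the value of the functional at
  \<open>g\<close> minus \<open>O(1 / n)\<close>, uniformly in \<open>g\<close>. This uses that \<open>g\<close> is the integral of its derivative
  (\<open>abs_continuous_has_integral\<close>).

\<^item> Upper bound (\<open>partition_sum_le\<close>). Group the configurations by their averages over blocks of
  length \<open>L\<close>. There are at most \<open>(q n + 1) ^ (n / L + 1)\<close> groups. The binomial weight of a group is
  bounded by its entropy (\<open>block_class_weight_le\<close>) and its energy is nearly constant
  (\<open>block_avg_tail\<close>), so a group contributes at most the exponential of \<open>n\<close> times the functional at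
  a piecewise linear path, up to an error of order \<open>L\<close>. With \<open>L\<close> about \<open>sqrt n\<close> all errors vanish.

For the inhomogeneous recursion, \<open>a i \<ge> 1\<close> and \<open>b i > 0\<close> give
\<open>x0 * (\<Prod>i<n. a i) \<le> x n \<le> (\<Prod>i<n. a i) * (x0 + (\<Sum>i<n. b i))\<close>. By independence the \<open>q\<close>-th moments of
the two bounds differ by a factor polynomial in \<open>n\<close> (\<open>inhomogeneous_moment_bounds\<close>), which does not
change the exponential rate.\<close>

section \<open>Exponential moments of Brownian motion\<close>

lemma has_bochner_integral_normal_density_exp:
  fixes c s :: real
  assumes "s > 0"
  shows "has_bochner_integral lborel (\<lambda>x. normal_density 0 s x * exp (c * x)) (exp (c\<^sup>2 * s\<^sup>2 / 2))"
proof -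
  have eq: "normal_density 0 s x * exp (c * x) = exp (c\<^sup>2 * s\<^sup>2 / 2) * normal_density (c * s\<^sup>2) s x" for x
  proof -
    \<comment> \<open>Completing the square turns the integrand into a shifted normal density.\<close>
    have "- (x - 0)\<^sup>2 / (2 * s\<^sup>2) + c * x = c\<^sup>2 * s\<^sup>2 / 2 + - (x - c * s\<^sup>2)\<^sup>2 / (2 * s\<^sup>2)"
      using assms by (simp add: field_simps power2_eq_square)
    then show ?thesis
      unfolding normal_density_def by (simp add: exp_add[symmetric] mult.assoc[symmetric] mult.commute)
  qed
  have "has_bochner_integral lborel (normal_density (c * s\<^sup>2) s) 1"
    using assms by (simp add: has_bochner_integral_iff)
  from has_bochner_integral_mult_right[OF this, of "exp (c\<^sup>2 * s\<^sup>2 / 2)"]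
  show ?thesis by (simp add: eq)
qed

lemma (in prob_space) normal_exp_moment:
  fixes c s :: real
  assumes "s > 0" and D: "distributed M lborel X (normal_density 0 s)"
  shows "integrable M (\<lambda>\<omega>. exp (c * X \<omega>))"
    and "expectation (\<lambda>\<omega>. exp (c * X \<omega>)) = exp (c\<^sup>2 * s\<^sup>2 / 2)"
proof -
  note B = has_bochner_integral_normal_density_exp[OF assms(1), of c]
  show "integrable M (\<lambda>\<omega>. exp (c * X \<omega>))"
    using distributed_integrable[OF D, of "\<lambda>x. exp (c * x)"] B by (simp add: has_bochner_integral_iff)
  show "expectation (\<lambda>\<omega>. exp (c * X \<omega>)) = exp (c\<^sup>2 * s\<^sup>2 / 2)"
    using distributed_integral[OF D, of "\<lambda>x. exp (c * x)"] B by (simp add: has_bochner_integral_iff)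
qed

lemma sum_by_parts_tail:
  fixes c w :: "nat \<Rightarrow> real"
  shows "(\<Sum>i<n. c i * w i) = w 0 * (\<Sum>i<n. c i) + (\<Sum>j\<in>{1..<n}. (\<Sum>i\<in>{j..<n}. c i) * (w j - w (j - 1)))"
proof (induction n)
  case (Suc n)
  have "(\<Sum>j\<in>{1..<Suc n}. (\<Sum>i\<in>{j..<Suc n}. c i) * (w j - w (j - 1)))
      = (\<Sum>j\<in>{1..<Suc n}. (\<Sum>i\<in>{j..<n}. c i) * (w j - w (j - 1)) + c n * (w j - w (j - 1)))"
    by (intro sum.cong) (auto simp: algebra_simps)
  also have "\<dots> = (\<Sum>j\<in>{1..<Suc n}. (\<Sum>i\<in>{j..<n}. c i) * (w j - w (j - 1))) + c n * (\<Sum>j\<in>{1..<Suc n}. w j - w (j - 1))"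
    by (simp only: sum.distrib sum_distrib_left)
  also have "(\<Sum>j\<in>{1..<Suc n}. w j - w (j - 1)) = (\<Sum>j<n. w (Suc j) - w j)"
    by (rule sum.reindex_bij_witness[of _ Suc "\<lambda>j. j - 1"]) auto
  also have "\<dots> = w n - w 0"
    by (rule sum_lessThan_telescope)
  also have "(\<Sum>j\<in>{1..<Suc n}. (\<Sum>i\<in>{j..<n}. c i) * (w j - w (j - 1))) = (\<Sum>j\<in>{1..<n}. (\<Sum>i\<in>{j..<n}. c i) * (w j - w (j - 1)))"
    by (cases n) auto
  finally show ?case using Suc by (simp add: algebra_simps)
qed simp

text \<open>Summation by parts rewrites a linear combination of the values of \<open>W\<close> as a linear combination of
its independent increments, with the tail sums of \<open>c\<close> as coefficients.\<close>
lemma brownian_exp_moment: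
  fixes c :: "nat \<Rightarrow> real"
  assumes BM: "brownian_motion M W" and \<tau>: "\<tau> > 0"
  shows "integrable M (\<lambda>\<omega>. exp (\<Sum>i<n. c i * W (real i * \<tau>) \<omega>))" (is ?int)
    and "(\<integral>\<omega>. exp (\<Sum>i<n. c i * W (real i * \<tau>) \<omega>) \<partial>M)
       = exp (\<tau> / 2 * (\<Sum>j\<in>{1..<n}. (\<Sum>i\<in>{j..<n}. c i)\<^sup>2))" (is ?eq)
proof -
  interpret prob_space M using BM by (simp add: brownian_motion_def)
  define X where "X j \<omega> = W (real (Suc j) * \<tau>) \<omega> - W (real j * \<tau>) \<omega>" for j \<omega>
  define T where "T j = (\<Sum>i\<in>{j..<n}. c i)" for j
  have meas[measurable]: "W (real i * \<tau>) \<in> borel_measurable M" for i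
    using BM \<tau> by (simp add: brownian_motion_def)
  have X_meas[measurable]: "X j \<in> borel_measurable M" for j
    unfolding X_def[abs_def] by (intro borel_measurable_diff meas)
  have W0: "AE \<omega> in M. W 0 \<omega> = 0"
    using BM by (simp add: brownian_motion_def)
  have indep: "indep_vars (\<lambda>_. borel) X {..<n - 1}"
  proof -
    have "0 \<le> real 0 * \<tau> \<and> mono_on {..n - 1} (\<lambda>i. real i * \<tau>)"
      using \<tau> by (auto simp: mono_on_def)
    with BM have "indep_vars (\<lambda>_. borel) (\<lambda>i \<omega>. W (real (Suc i) * \<tau>) \<omega> - W (real i * \<tau>) \<omega>) {..<n - 1}"
      unfolding brownian_motion_def by (elim conjE allE[where x="n - 1"] allE[where x="\<lambda>i. real i * \<tau>"]) auto
    then show ?thesis by (simp add: X_def[abs_def])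
  qed
  have dist: "distributed M lborel (X j) (normal_density 0 (sqrt \<tau>))" for j
  proof -
    have "distributed M lborel (\<lambda>\<omega>. W (real (Suc j) * \<tau>) \<omega> - W (real j * \<tau>) \<omega>)
            (normal_density 0 (sqrt (real (Suc j) * \<tau> - real j * \<tau>)))"
      using BM \<tau> unfolding brownian_motion_def by auto
    then show ?thesis by (simp add: X_def[abs_def] algebra_simps)
  qed
  have AEeq: "AE \<omega> in M. exp (\<Sum>i<n. c i * W (real i * \<tau>) \<omega>) = (\<Prod>j<n - 1. exp (T (Suc j) * X j \<omega>))"
    using W0
  proof eventually_elim
    case (elim \<omega>)
    have "(\<Sum>i<n. c i * W (real i * \<tau>) \<omega>) = (\<Sum>j\<in>{1..<n}. T j * X (j - 1) \<omega>)"
      unfolding sum_by_parts_tail[of c "\<lambda>i. W (real i * \<tau>) \<omega>" n] using elim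
      by (auto simp: T_def X_def intro!: sum.cong)
    also have "\<dots> = (\<Sum>j<n - 1. T (Suc j) * X j \<omega>)"
      by (rule sum.reindex_bij_witness[of _ Suc "\<lambda>j. j - 1"]) auto
    finally show ?case by (simp add: exp_sum)
  qed
  have int1: "integrable M (\<lambda>\<omega>. exp (T (Suc j) * X j \<omega>))" for j
    by (rule normal_exp_moment[OF _ dist]) (use \<tau> in simp)
  have ind2: "indep_vars (\<lambda>_. borel) (\<lambda>j \<omega>. exp (T (Suc j) * X j \<omega>)) {..<n - 1}"
    by (rule indep_vars_compose2[OF indep]) auto
  have "integrable M (\<lambda>\<omega>. \<Prod>j<n - 1. exp (T (Suc j) * X j \<omega>))"
    by (rule indep_vars_integrable[OF _ ind2 int1]) simp
  then show ?int
    using AEeq by (subst integrable_cong_AE[OF _ _ AEeq]) auto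
  have "(\<integral>\<omega>. exp (\<Sum>i<n. c i * W (real i * \<tau>) \<omega>) \<partial>M) = (\<integral>\<omega>. (\<Prod>j<n - 1. exp (T (Suc j) * X j \<omega>)) \<partial>M)"
    by (rule integral_cong_AE[OF _ _ AEeq]) auto
  also have "\<dots> = (\<Prod>j<n - 1. \<integral>\<omega>. exp (T (Suc j) * X j \<omega>) \<partial>M)"
    by (rule indep_vars_lebesgue_integral[OF _ ind2 int1]) simp
  also have "\<dots> = (\<Prod>j<n - 1. exp (\<tau> / 2 * (T (Suc j))\<^sup>2))"
    by (intro prod.cong refl, subst normal_exp_moment(2)[OF _ dist]) (use \<tau> in \<open>auto simp: mult_ac\<close>)
  also have "\<dots> = exp (\<Sum>j<n - 1. \<tau> / 2 * (T (Suc j))\<^sup>2)"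
    by (simp add: exp_sum)
  also have "(\<Sum>j<n - 1. \<tau> / 2 * (T (Suc j))\<^sup>2) = (\<Sum>j\<in>{1..<n}. \<tau> / 2 * (T j)\<^sup>2)"
    by (rule sum.reindex_bij_witness[of _ "\<lambda>j. j - 1" Suc]) auto
  finally show ?eq by (simp add: T_def sum_distrib_left)
qed

section \<open>The moment as a partition function\<close>

text \<open>The \<open>q\<close>-th moment of \<open>\<Prod>i<n. a i\<close>. A configuration \<open>k\<close> records, for each \<open>i\<close>, how many of
the \<open>q\<close> factors \<open>a i = 1 + \<rho> \<dots>\<close> contribute their random summand. The exponent is the
attractive mean-field energy which the common Brownian path induces between the sites.
Only partial sums of \<open>k\<close> from the right enter it, which is what gives the scaling limit its
dependence on \<open>g 1 - g x\<close>.\<close>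
definition partition_sum :: "real \<Rightarrow> real \<Rightarrow> nat \<Rightarrow> nat \<Rightarrow> real" where
  "partition_sum \<rho> \<beta> q n =
     (\<Sum>k\<in>{..<n} \<rightarrow>\<^sub>E {..q}. (\<Prod>i<n. real (q choose k i) * \<rho> ^ k i)
        * exp (\<beta> / (real n)\<^sup>2 * (\<Sum>j\<in>{1..<n}. (\<Sum>i\<in>{j..<n}. real (k i))\<^sup>2 - (\<Sum>i\<in>{j..<n}. real (k i)))))"

text \<open>Expanding every \<open>a i ^ q\<close> by the binomial theorem leaves exponentials of linear combinations of
the \<open>W (i \<tau>)\<close>. Their Gaussian moments give the squares of the tail sums; the compensators
\<open>- \<sigma>\<^sup>2 t\<^sub>i / 2\<close> give the linear term, since \<open>\<Sum>i. i * k i\<close> is the sum of all tail sums.\<close>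
lemma moment_prod_mult_coeff:
  fixes M :: "'a measure"
  assumes BM: "brownian_motion M W" and \<tau>: "\<tau> > 0" and n: "n \<ge> 1"
    and scale: "1/2 * \<sigma>\<^sup>2 * \<tau> * (real n)\<^sup>2 = \<beta>"
  shows "integrable M (\<lambda>\<omega>. (\<Prod>i<n. mult_coeff W \<rho> \<sigma> \<tau> i \<omega>) ^ q)" (is ?int)
    and "(\<integral>\<omega>. (\<Prod>i<n. mult_coeff W \<rho> \<sigma> \<tau> i \<omega>) ^ q \<partial>M) = partition_sum \<rho> \<beta> q n" (is ?eq)
proof -
  let ?K = "{..<n} \<rightarrow>\<^sub>E {..q}"
  define C where "C k = (\<Prod>i<n. real (q choose k i) * \<rho> ^ k i)" for k :: "nat \<Rightarrow> nat"
  define T where "T k j = (\<Sum>i\<in>{j..<n}. real (k i))" for k :: "nat \<Rightarrow> nat" and j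
  define D where "D k = exp (- (\<sigma>\<^sup>2 * \<tau> / 2) * (\<Sum>j\<in>{1..<n}. T k j))" for k :: "nat \<Rightarrow> nat"
  define E where "E k \<omega> = exp (\<Sum>i<n. (\<sigma> * real (k i)) * W (real i * \<tau>) \<omega>)" for k :: "nat \<Rightarrow> nat" and \<omega>
  have expand: "(\<Prod>i<n. mult_coeff W \<rho> \<sigma> \<tau> i \<omega>) ^ q = (\<Sum>k\<in>?K. C k * D k * E k \<omega>)" for \<omega>
  proof -
    define z where "z i = \<sigma> * W (real i * \<tau>) \<omega> - 1/2 * \<sigma>\<^sup>2 * (real i * \<tau>)" for i
    have "(\<Prod>i<n. mult_coeff W \<rho> \<sigma> \<tau> i \<omega>) ^ q = (\<Prod>i<n. (\<rho> * exp (z i) + 1) ^ q)"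
      by (simp add: mult_coeff_def z_def prod_power_distrib add.commute)
    also have "\<dots> = (\<Prod>i<n. \<Sum>k\<le>q. real (q choose k) * (\<rho> * exp (z i)) ^ k)"
      by (simp add: binomial_ring)
    also have "\<dots> = (\<Sum>k\<in>?K. \<Prod>i<n. real (q choose k i) * (\<rho> * exp (z i)) ^ k i)"
      by (subst prod_sum_PiE) auto
    also have "\<dots> = (\<Sum>k\<in>?K. C k * exp (\<Sum>i<n. real (k i) * z i))"
      by (intro sum.cong refl)
        (simp add: C_def exp_sum power_mult_distrib prod.distrib[symmetric] exp_of_nat_mult[symmetric] mult_ac)
    also have "\<dots> = (\<Sum>k\<in>?K. C k * D k * E k \<omega>)"
    proof (intro sum.cong refl)
      fix k
      have "(\<Sum>i<n. real (k i) * real i) = (\<Sum>j\<in>{1..<n}. T k j)"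
        by (simp add: sum_by_parts_tail[of "\<lambda>i. real (k i)" real] T_def)
      moreover have "real (k i) * z i
          = (\<sigma> * real (k i)) * W (real i * \<tau>) \<omega> + - (\<sigma>\<^sup>2 * \<tau> / 2) * (real (k i) * real i)" for i
        by (simp add: z_def algebra_simps)
      ultimately have "(\<Sum>i<n. real (k i) * z i)
          = (\<Sum>i<n. (\<sigma> * real (k i)) * W (real i * \<tau>) \<omega>) + - (\<sigma>\<^sup>2 * \<tau> / 2) * (\<Sum>j\<in>{1..<n}. T k j)"
        by (simp only: sum.distrib sum_distrib_left[symmetric])
      then show "C k * exp (\<Sum>i<n. real (k i) * z i) = C k * D k * E k \<omega>"
        by (simp add: D_def E_def exp_add[symmetric])
    qed
    finally show ?thesis .
  qed
  have intE: "integrable M (E k)" for k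
    unfolding E_def[abs_def] by (rule brownian_exp_moment[OF BM \<tau>])
  show ?int unfolding expand
    by (intro Bochner_Integration.integrable_sum integrable_mult_right intE)
  have "(\<integral>\<omega>. (\<Prod>i<n. mult_coeff W \<rho> \<sigma> \<tau> i \<omega>) ^ q \<partial>M) = (\<Sum>k\<in>?K. C k * D k * (\<integral>\<omega>. E k \<omega> \<partial>M))"
    unfolding expand using intE by (subst Bochner_Integration.integral_sum) auto
  also have "\<dots> = partition_sum \<rho> \<beta> q n"
    unfolding partition_sum_def
  proof (intro sum.cong refl)
    fix k
    have b: "\<beta> / (real n)\<^sup>2 = \<sigma>\<^sup>2 * \<tau> / 2"
      using scale n by (auto simp: field_simps)
    have "(\<integral>\<omega>. E k \<omega> \<partial>M) = exp (\<tau> / 2 * (\<Sum>j\<in>{1..<n}. (\<sigma> * T k j)\<^sup>2))"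
      unfolding E_def brownian_exp_moment[OF BM \<tau>] T_def by (simp add: sum_distrib_left)
    then have "D k * (\<integral>\<omega>. E k \<omega> \<partial>M) = exp (\<beta> / (real n)\<^sup>2 * (\<Sum>j\<in>{1..<n}. (T k j)\<^sup>2 - T k j))"
      unfolding b by (simp add: D_def exp_add[symmetric] sum_subtractf power_mult_distrib
          sum_distrib_left[symmetric] algebra_simps)
    then show "C k * D k * (\<integral>\<omega>. E k \<omega> \<partial>M) = (\<Prod>i<n. real (q choose k i) * \<rho> ^ k i)
        * exp (\<beta> / (real n)\<^sup>2 * (\<Sum>j\<in>{1..<n}. (\<Sum>i\<in>{j..<n}. real (k i))\<^sup>2 - (\<Sum>i\<in>{j..<n}. real (k i))))"
      by (simp add: C_def T_def mult.assoc)
  qed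
  finally show ?eq .
qed

section \<open>The fundamental theorem of calculus for absolutely continuous functions\<close>

text \<open>Henstock's gauge integral makes this direct. At points of differentiability the gauge is chosen
as in the classical fundamental theorem. At points of the exceptional null set \<open>N\<close> it keeps the
intervals inside an open set \<open>U \<supseteq> N\<close> of measure less than the \<open>\<delta>\<close> of absolute continuity, so
that these intervals carry only a small part of the variation of \<open>g\<close>.\<close>
lemma abs_continuous_has_integral:
  fixes g f :: "real \<Rightarrow> real"
  assumes lr: "l \<le> r" and AC: "abs_continuous_on_Icc l r g" and N: "negligible N"
    and der: "\<And>x. x \<in> {l..r} - N \<Longrightarrow> (g has_real_derivative f x) (at x within {l..r})"
  shows "(f has_integral (g r - g l)) {l..r}"
proof (cases "l = r")
  case True
  then show ?thesis by (simp add: has_integral_refl)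
next
  case False
  with lr have "l < r" by simp
  \<comment> \<open>With the value \<open>0\<close> on \<open>N\<close>, tagged intervals with tag in \<open>N\<close> contribute only increments
    of \<open>g\<close> to the error.\<close>
  define f0 where "f0 x = (if x \<in> N then 0 else f x)" for x
  have "(f0 has_integral (g r - g l)) {l..r}"
    unfolding has_integral_factor_content_real
  proof (intro allI impI)
    fix e :: real assume "e > 0"
    then have "e / 2 * (r - l) > 0" using \<open>l < r\<close> by simp
    then obtain \<delta> where "\<delta> > 0" and \<delta>: "\<And>D. finite D \<Longrightarrow> (\<forall>(u, v)\<in>D. l \<le> u \<and> u \<le> v \<and> v \<le> r) \<Longrightarrow>
        pairwise (\<lambda>(u, v) (u', v'). {u<..<v} \<inter> {u'<..<v'} = {}) D \<Longrightarrow>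
        (\<Sum>(u, v)\<in>D. v - u) < \<delta> \<Longrightarrow> (\<Sum>(u, v)\<in>D. \<bar>g v - g u\<bar>) < e / 2 * (r - l)"
      using AC unfolding abs_continuous_on_Icc_def by meson
    obtain U where U: "open U" "N \<subseteq> U" "emeasure lebesgue U < ennreal \<delta>"
    proof -
      have Nnull: "N \<in> null_sets lebesgue" using N by (simp add: negligible_iff_null_sets)
      obtain U where "open U" "N \<subseteq> U" "U - N \<in> lmeasurable" "emeasure lebesgue (U - N) < ennreal \<delta>"
        using sets_lebesgue_outer_open[of N \<delta>] Nnull \<open>\<delta> > 0\<close> by auto
      moreover have "emeasure lebesgue ((U - N) \<union> N) = emeasure lebesgue (U - N)"
        using Nnull \<open>U - N \<in> lmeasurable\<close> by (intro emeasure_Un_null_set) auto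
      moreover have "(U - N) \<union> N = U" using \<open>N \<subseteq> U\<close> by auto
      ultimately show ?thesis using that by simp
    qed
    have "\<exists>d>0. (x \<in> N \<longrightarrow> ball x d \<subseteq> U) \<and> (x \<in> {l..r} - N \<longrightarrow>
            (\<forall>y\<in>{l..r}. norm (y - x) < d \<longrightarrow> norm (g y - g x - (y - x) *\<^sub>R f x) \<le> e / 2 * norm (y - x)))" for x
    proof (cases "x \<in> N")
      case True
      then show ?thesis using U(1,2) by (auto simp: open_contains_ball)
    next
      case False
      show ?thesis
      proof (cases "x \<in> {l..r}")
        case True
        then have "(g has_vector_derivative f x) (at x within {l..r})"
          using der[of x] False by (simp add: has_real_derivative_iff_has_vector_derivative)
        then show ?thesis
          using False \<open>e > 0\<close> unfolding has_vector_derivative_def has_derivative_within_alt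
          by (metis half_gt_zero)
      qed (use False in \<open>auto intro: exI[of _ 1]\<close>)
    qed
    then obtain d where d: "\<And>x. 0 < d x" "\<And>x. x \<in> N \<Longrightarrow> ball x (d x) \<subseteq> U"
      and dd: "\<And>x y. x \<in> {l..r} - N \<Longrightarrow> y \<in> {l..r} \<Longrightarrow> norm (y - x) < d x \<Longrightarrow>
            norm (g y - g x - (y - x) *\<^sub>R f x) \<le> e / 2 * norm (y - x)"
      by metis
    show "\<exists>d. gauge d \<and> (\<forall>p. p tagged_division_of {l..r} \<and> d fine p \<longrightarrow>
      norm ((\<Sum>(x, k)\<in>p. measure lborel k *\<^sub>R f0 x) - (g r - g l)) \<le> e * measure lborel {l..r})"
    proof (intro exI[of _ "\<lambda>x. ball x (d x)"] conjI allI impI)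
      show "gauge (\<lambda>x. ball x (d x))" using d(1) gauge_ball_dependent by blast
    next
      fix p assume "p tagged_division_of {l..r} \<and> (\<lambda>x. ball x (d x)) fine p"
      then have p: "p tagged_division_of {l..r}" and fine: "(\<lambda>x. ball x (d x)) fine p" by auto
      note pD = tagged_division_ofD[OF p]
      have shape: "l \<le> Inf K \<and> Inf K \<le> x \<and> x \<le> Sup K \<and> Sup K \<le> r \<and> K = {Inf K..Sup K}"
        if "(x, K) \<in> p" for x K
      proof -
        obtain a b where "K = cbox a b" using pD(4)[OF \<open>(x, K) \<in> p\<close>] by auto
        with pD(2,3)[OF \<open>(x, K) \<in> p\<close>] show ?thesis by (auto simp: atLeastatMost_subset_iff)
      qed
      have len: "(\<Sum>(x,K)\<in>p. Sup K - Inf K) = r - l" and tele: "(\<Sum>(x,K)\<in>p. g (Sup K) - g (Inf K)) = g r - g l"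
        using additive_tagged_division_1[OF lr p, of "\<lambda>x. x"] additive_tagged_division_1[OF lr p, of g] by auto
      define h where "h = (\<lambda>(x, K). measure lborel K *\<^sub>R f0 x - (g (Sup K) - g (Inf K)))"
      define p1 where "p1 = {z \<in> p. fst z \<notin> N}"
      define p2 where "p2 = {z \<in> p. fst z \<in> N}"
      have fin: "finite p" "finite p1" "finite p2" using pD(1) by (auto simp: p1_def p2_def)
      have "(\<Sum>(x, k)\<in>p. measure lborel k *\<^sub>R f0 x) - (g r - g l) = (\<Sum>z\<in>p. h z)"
        unfolding tele[symmetric] h_def sum_subtractf[symmetric] by (intro sum.cong) auto
      also have "\<dots> = (\<Sum>z\<in>p1. h z) + (\<Sum>z\<in>p2. h z)"
        unfolding p1_def p2_def using fin(1)
        by (subst sum.union_disjoint[symmetric]) (auto intro!: sum.cong)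
      finally have split: "(\<Sum>(x, k)\<in>p. measure lborel k *\<^sub>R f0 x) - (g r - g l) = (\<Sum>z\<in>p1. h z) + (\<Sum>z\<in>p2. h z)" .
      have b1: "norm (\<Sum>z\<in>p1. h z) \<le> e / 2 * (r - l)"
      proof -
        have "norm (\<Sum>z\<in>p1. h z) \<le> (\<Sum>z\<in>p1. e / 2 * (case z of (x, K) \<Rightarrow> Sup K - Inf K))"
        proof (rule sum_norm_le)
          fix z assume "z \<in> p1"
          then obtain x K where z: "z = (x, K)" and xK: "(x, K) \<in> p" and "x \<notin> N"
            by (cases z) (auto simp: p1_def)
          note s = shape[OF xK]
          have Kb: "K \<subseteq> ball x (d x)" using fine xK by (auto simp: fine_def)
          have in_K: "Inf K \<in> K" "Sup K \<in> K"
            using s by (metis atLeastAtMost_iff order.trans order_refl)+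
          have dist1: "norm (Inf K - x) < d x" "norm (Sup K - x) < d x"
            using Kb in_K by (auto simp: dist_real_def)
          have "norm (g (Inf K) - g x - (Inf K - x) *\<^sub>R f x) \<le> e / 2 * norm (Inf K - x)"
            using s \<open>x \<notin> N\<close> dist1 by (intro dd) auto
          moreover have "norm (g (Sup K) - g x - (Sup K - x) *\<^sub>R f x) \<le> e / 2 * norm (Sup K - x)"
            using s \<open>x \<notin> N\<close> dist1 by (intro dd) auto
          moreover have "norm (Inf K - x) + norm (Sup K - x) = Sup K - Inf K" using s by auto
          moreover have "measure lborel K = Sup K - Inf K"
            using s by (metis content_real order.trans)
          moreover have "e / 2 * norm (Inf K - x) + e / 2 * norm (Sup K - x) = e / 2 * (norm (Inf K - x) + norm (Sup K - x))"
            by (simp add: algebra_simps)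
          moreover have "h z = (g (Inf K) - g x - (Inf K - x) *\<^sub>R f x) - (g (Sup K) - g x - (Sup K - x) *\<^sub>R f x)"
          proof -
            have "h z = (Sup K - Inf K) * f x - (g (Sup K) - g (Inf K))"
              using \<open>x \<notin> N\<close> \<open>measure lborel K = Sup K - Inf K\<close> by (simp add: h_def z f0_def)
            then show ?thesis by (simp add: algebra_simps)
          qed
          moreover have "norm ((g (Inf K) - g x - (Inf K - x) *\<^sub>R f x) - (g (Sup K) - g x - (Sup K - x) *\<^sub>R f x))
             \<le> norm (g (Inf K) - g x - (Inf K - x) *\<^sub>R f x) + norm (g (Sup K) - g x - (Sup K - x) *\<^sub>R f x)"
            by (rule norm_triangle_ineq4)
          ultimately show "norm (h z) \<le> e / 2 * (case z of (x, K) \<Rightarrow> Sup K - Inf K)"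
            by (simp add: z)
        qed
        also have "\<dots> \<le> (\<Sum>z\<in>p. e / 2 * (case z of (x, K) \<Rightarrow> Sup K - Inf K))"
          using fin \<open>e > 0\<close> by (intro sum_mono2) (auto simp: p1_def dest!: shape)
        also have "\<dots> = e / 2 * (r - l)"
          by (simp only: sum_distrib_left[symmetric] len)
        finally show ?thesis .
      qed
      have b2: "norm (\<Sum>z\<in>p2. h z) \<le> e / 2 * (r - l)"
      proof -
        \<comment> \<open>Degenerate intervals are discarded so that distinct tagged intervals have distinct end
          points.\<close>
        define p3 where "p3 = {z \<in> p2. Inf (snd z) < Sup (snd z)}"
        define \<phi> :: "real \<times> real set \<Rightarrow> real \<times> real" where "\<phi> z = (Inf (snd z), Sup (snd z))" for z
        have fin3: "finite p3" using fin by (simp add: p3_def)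
        have intr: "interior (snd z) = {Inf (snd z)<..<Sup (snd z)}" if "z \<in> p" for z
          using shape[of "fst z" "snd z"] that by (metis interior_atLeastAtMost_real prod.collapse)
        have disj: "{Inf (snd z)<..<Sup (snd z)} \<inter> {Inf (snd w)<..<Sup (snd w)} = {}"
          if "z \<in> p" "w \<in> p" "z \<noteq> w" for z w
          using pD(5)[of "fst z" "snd z" "fst w" "snd w"] intr[OF that(1)] intr[OF that(2)] that by auto
        have inj: "inj_on \<phi> p3"
        proof (rule inj_onI, rule ccontr)
          fix z w assume *: "z \<in> p3" "w \<in> p3" "\<phi> z = \<phi> w" "z \<noteq> w"
          with disj[of z w] have "{Inf (snd z)<..<Sup (snd z)} = {}"
            by (auto simp: p3_def p2_def \<phi>_def)
          with * show False by (auto simp: p3_def)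
        qed
        have sumD: "(\<Sum>(u, v)\<in>\<phi> ` p3. F u v) = (\<Sum>z\<in>p3. F (Inf (snd z)) (Sup (snd z)))" for F :: "real \<Rightarrow> real \<Rightarrow> real"
          by (subst sum.reindex[OF inj]) (simp add: \<phi>_def)
        have "(\<Sum>z\<in>p3. Sup (snd z) - Inf (snd z)) < \<delta>"
        proof -
          have "(\<Sum>z\<in>p3. Sup (snd z) - Inf (snd z)) = (\<Sum>z\<in>p3. measure lebesgue {Inf (snd z)<..<Sup (snd z)})"
            by (intro sum.cong) (auto simp: p3_def)
          also have "\<dots> = measure lebesgue (\<Union>z\<in>p3. {Inf (snd z)<..<Sup (snd z)})"
            using fin3 disj by (intro measure_UNION'[symmetric]) (auto simp: pairwise_def disjnt_def p3_def p2_def)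
          also have "\<dots> \<le> measure lebesgue U"
          proof (rule measure_mono_fmeasurable)
            show "(\<Union>z\<in>p3. {Inf (snd z)<..<Sup (snd z)}) \<subseteq> U"
            proof
              fix y assume "y \<in> (\<Union>z\<in>p3. {Inf (snd z)<..<Sup (snd z)})"
              then obtain z where z: "z \<in> p3" "y \<in> {Inf (snd z)<..<Sup (snd z)}" by auto
              then have zp: "(fst z, snd z) \<in> p" "fst z \<in> N" by (auto simp: p3_def p2_def)
              then have "y \<in> snd z" using z intr[of z] interior_subset by (metis prod.collapse subsetD)
              moreover have "snd z \<subseteq> ball (fst z) (d (fst z))"
                using fine zp(1) unfolding fine_def by blast
              ultimately show "y \<in> U" using d(2)[OF zp(2)] by blast
            qed
            show "U \<in> lmeasurable"
              using U by (auto simp: fmeasurable_def intro: less_trans)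
          qed (auto intro: fin3)
          also have "\<dots> < \<delta>"
            using U(3) \<open>\<delta> > 0\<close> by (metis emeasure_eq_ennreal_measure ennreal_less_iff measure_nonneg top.not_eq_extremum ennreal_less_top less_trans less_irrefl)
          finally show ?thesis .
        qed
        then have "(\<Sum>(u, v)\<in>\<phi> ` p3. \<bar>g v - g u\<bar>) < e / 2 * (r - l)"
        proof (intro \<delta>)
          show "\<forall>(u, v)\<in>\<phi> ` p3. l \<le> u \<and> u \<le> v \<and> v \<le> r"
            using shape by (fastforce simp: \<phi>_def p3_def p2_def)
          show "pairwise (\<lambda>(u, v) (u', v'). {u<..<v} \<inter> {u'<..<v'} = {}) (\<phi> ` p3)"
          proof (rule pairwiseI)
            fix a b assume "a \<in> \<phi> ` p3" "b \<in> \<phi> ` p3" "a \<noteq> b"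
            then obtain z w where "a = \<phi> z" "b = \<phi> w" "z \<in> p3" "w \<in> p3" "z \<noteq> w" by auto
            then show "(\<lambda>(u, v) (u', v'). {u<..<v} \<inter> {u'<..<v'} = {}) a b"
              using disj[of z w] by (simp add: \<phi>_def p3_def p2_def)
          qed
        qed (use fin3 in \<open>auto simp: sumD\<close>)
        then have "(\<Sum>z\<in>p3. \<bar>g (Sup (snd z)) - g (Inf (snd z))\<bar>) < e / 2 * (r - l)"
          by (simp add: sumD)
        moreover have "(\<Sum>z\<in>p2. norm (h z)) = (\<Sum>z\<in>p3. \<bar>g (Sup (snd z)) - g (Inf (snd z))\<bar>)"
        proof (rule sum.mono_neutral_cong_right)
          show "\<forall>z\<in>p2 - p3. norm (h z) = 0"
          proof
            fix z assume z: "z \<in> p2 - p3"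
            then have "Inf (snd z) = Sup (snd z)"
              using shape[of "fst z" "snd z"] by (auto simp: p3_def p2_def)
            then show "norm (h z) = 0" using z by (auto simp: h_def p2_def f0_def split: prod.splits)
          qed
        qed (use fin in \<open>auto simp: p3_def p2_def h_def f0_def\<close>)
        moreover have "norm (\<Sum>z\<in>p2. h z) \<le> (\<Sum>z\<in>p2. norm (h z))" by (rule norm_sum)
        ultimately show ?thesis by linarith
      qed
      have "norm ((\<Sum>z\<in>p1. h z) + (\<Sum>z\<in>p2. h z)) \<le> e / 2 * (r - l) + e / 2 * (r - l)"
        using b1 b2 by (intro norm_triangle_mono)
      then show "norm ((\<Sum>(x, k)\<in>p. measure lborel k *\<^sub>R f0 x) - (g r - g l)) \<le> e * measure lborel {l..r}"
        unfolding split using lr by simp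
    qed
  qed
  then show ?thesis
    by (rule has_integral_spike[OF N, rotated]) (auto simp: f0_def)
qed

section \<open>The entropy function and admissible paths\<close>

definition rate_functional :: "real \<Rightarrow> real \<Rightarrow> nat \<Rightarrow> (real \<Rightarrow> real) \<Rightarrow> real" where
  "rate_functional \<rho> \<beta> q g =
     g 1 * ln \<rho> + \<beta> * integral {0..1} (\<lambda>x. (g 1 - g x)\<^sup>2)
       - real q * integral {0..1} (\<lambda>x. I_fun (deriv g x / real q))"

text \<open>Nonnegativity of the relative entropy of two Bernoulli distributions, from \<open>ln x \<le> x - 1\<close>.\<close>
lemma I_fun_gibbs:
  assumes "0 \<le> p" "p \<le> 1" "0 < u" "u < 1"
  shows "p * ln u + (1 - p) * ln (1 - u) \<le> I_fun p"
proof -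
  have aux: "a * ln b \<le> a * ln a + (b - a)" if "0 \<le> a" "0 < b" for a b :: real
  proof (cases "a = 0")
    case False
    with that have "a > 0" by simp
    then have "a * (ln b - ln a) \<le> a * (b / a - 1)"
      using that ln_le_minus_one[of "b / a"] by (intro mult_left_mono) (auto simp: ln_div)
    with \<open>a > 0\<close> show ?thesis by (simp add: algebra_simps)
  qed (use that in auto)
  show ?thesis
    using aux[of p u] aux[of "1 - p" "1 - u"] assms by (simp add: I_fun_def)
qed

text \<open>Half of the convex duality between \<open>I_fun\<close> and the logarithmic moment generating function
\<open>\<theta> \<mapsto> ln (1 + exp \<theta>)\<close>: the Gibbs inequality at the optimal tilt \<open>u = exp \<theta> / (1 + exp \<theta>)\<close>.\<close>
lemma I_fun_legendre:
  assumes "0 \<le> p" "p \<le> 1"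
  shows "\<theta> * p - I_fun p \<le> ln (1 + exp \<theta>)"
proof -
  have pos: "1 + exp \<theta> > 0" by (simp add: add_pos_pos)
  define u where "u = exp \<theta> / (1 + exp \<theta>)"
  have u: "0 < u" "u < 1" and u1: "1 - u = 1 / (1 + exp \<theta>)"
    using pos by (auto simp: u_def field_simps)
  have l1: "ln u = \<theta> - ln (1 + exp \<theta>)" using pos by (simp add: u_def ln_div)
  have l2: "ln (1 - u) = - ln (1 + exp \<theta>)" using pos by (simp add: u1 ln_div)
  show ?thesis
    using I_fun_gibbs[OF assms u] unfolding l1 l2 by (simp add: algebra_simps)
qed

lemma I_fun_nonpos:
  assumes "0 \<le> p" "p \<le> 1"
  shows "I_fun p \<le> 0"
proof -
  have aux: "x * ln x \<le> 0" if "0 \<le> x" "x \<le> 1" for x :: real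
    using that by (cases "x = 0") (auto simp: mult_nonneg_nonpos)
  show ?thesis using aux[of p] aux[of "1 - p"] assms by (simp add: I_fun_def)
qed

lemma abs_continuous_on_Icc_subset:
  assumes AC: "abs_continuous_on_Icc l r g" and "l \<le> u" "v \<le> r"
  shows "abs_continuous_on_Icc u v g"
  unfolding abs_continuous_on_Icc_def
proof (intro allI impI)
  fix \<epsilon> :: real assume "\<epsilon> > 0"
  then obtain \<delta> where "\<delta> > 0" and \<delta>: "\<And>D. finite D \<Longrightarrow> (\<forall>(a, b)\<in>D. l \<le> a \<and> a \<le> b \<and> b \<le> r) \<Longrightarrow>
      pairwise (\<lambda>(u, v) (u', v'). {u<..<v} \<inter> {u'<..<v'} = {}) D \<Longrightarrow>
      (\<Sum>(u, v)\<in>D. v - u) < \<delta> \<Longrightarrow> (\<Sum>(u, v)\<in>D. \<bar>g v - g u\<bar>) < \<epsilon>"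
    using AC unfolding abs_continuous_on_Icc_def by meson
  have "\<forall>(a, b)\<in>D. l \<le> a \<and> a \<le> b \<and> b \<le> r" if "\<forall>(a, b)\<in>D. u \<le> a \<and> a \<le> b \<and> b \<le> v" for D
    using that assms(2,3) by force
  then show "\<exists>\<delta>>0. \<forall>D. finite D \<and> (\<forall>(a, b)\<in>D. u \<le> a \<and> a \<le> b \<and> b \<le> v) \<and>
      pairwise (\<lambda>(u, v) (u', v'). {u<..<v} \<inter> {u'<..<v'} = {}) D \<and>
      (\<Sum>(u, v)\<in>D. v - u) < \<delta> \<longrightarrow> (\<Sum>(u, v)\<in>D. \<bar>g v - g u\<bar>) < \<epsilon>"
    using \<open>\<delta> > 0\<close> by (intro exI[of _ \<delta>] conjI allI impI \<delta>) (elim conjE, assumption | blast)+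
qed

text \<open>Setting \<open>deriv g\<close> to \<open>0\<close> off the unit interval and on the exceptional null set gives a density
of \<open>g\<close> whose bounds hold everywhere.\<close>
lemma admissible_density:
  assumes "g \<in> admissible q"
  obtains f N where "negligible N" "\<And>x. 0 \<le> f x" "\<And>x. f x \<le> real q"
    "\<And>x. x \<in> {0..1} - N \<Longrightarrow> f x = deriv g x"
    "\<And>u v. 0 \<le> u \<Longrightarrow> u \<le> v \<Longrightarrow> v \<le> 1 \<Longrightarrow> (f has_integral (g v - g u)) {u..v}"
proof -
  have AC: "abs_continuous_on_Icc 0 1 g"
    and ae: "AE x in lborel. x \<in> {0..1} \<longrightarrow> g differentiable (at x) \<and> 0 \<le> deriv g x \<and> deriv g x \<le> real q"
    using assms by (auto simp: admissible_def)
  from ae obtain N where N: "N \<in> null_sets lborel"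
    and good: "\<And>x. x \<in> {0..1} - N \<Longrightarrow> g differentiable (at x) \<and> 0 \<le> deriv g x \<and> deriv g x \<le> real q"
    by (auto elim!: AE_E3)
  have neg: "negligible N"
    using N by (simp add: negligible_iff_null_sets null_sets_completionI)
  define f where "f x = (if x \<in> {0..1} - N then deriv g x else 0)" for x
  have "(f has_integral (g v - g u)) {u..v}" if uv: "0 \<le> u" "u \<le> v" "v \<le> 1" for u v
  proof (rule abs_continuous_has_integral[OF uv(2) _ neg])
    show "abs_continuous_on_Icc u v g"
      by (rule abs_continuous_on_Icc_subset[OF AC]) (use uv in auto)
    fix x assume "x \<in> {u..v} - N"
    with uv have x: "x \<in> {0..1} - N" by auto
    with good have "(g has_real_derivative deriv g x) (at x)"
      using DERIV_deriv_iff_real_differentiable by blast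
    with x show "(g has_real_derivative f x) (at x within {u..v})"
      by (simp add: f_def has_field_derivative_at_within)
  qed
  moreover have "0 \<le> f x" "f x \<le> real q" for x using good by (auto simp: f_def)
  ultimately show ?thesis using that[OF neg, of f] by (auto simp: f_def)
qed

lemma admissible_increment:
  assumes "g \<in> admissible q" "0 \<le> u" "u \<le> v" "v \<le> 1"
  shows "g u \<le> g v" "g v - g u \<le> real q * (v - u)"
proof -
  obtain f where f: "\<And>x. 0 \<le> f x" "\<And>x. f x \<le> real q" "(f has_integral (g v - g u)) {u..v}"
    using admissible_density[OF assms(1)] assms(2-4) by metis
  show "g u \<le> g v" using has_integral_nonneg[OF f(3)] f(1) by auto
  have "((\<lambda>x. real q) has_integral real q * (v - u)) {u..v}"
    using has_integral_const_real[of "real q" u v] assms by (simp add: mult.commute)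
  from has_integral_le[OF f(3) this] f(2) show "g v - g u \<le> real q * (v - u)" by auto
qed

lemma admissible_continuous:
  assumes "g \<in> admissible q"
  shows "continuous_on {0..1} g"
proof -
  have "\<bar>g x - g y\<bar> \<le> real q * \<bar>x - y\<bar>" if "x \<in> {0..1}" "y \<in> {0..1}" for x y
    using admissible_increment[OF assms, of x y] admissible_increment[OF assms, of y x] that
    by (cases "x \<le> y") auto
  then have "(real q)-lipschitz_on {0..1} g"
    by (auto simp: lipschitz_on_def dist_real_def)
  then show ?thesis by (rule lipschitz_on_continuous_on)
qed

lemma sum_integral_cells:
  fixes h :: "real \<Rightarrow> real"
  assumes "h integrable_on {0..1}" "n \<ge> 1"
  shows "(\<Sum>i<n. integral {real i / real n..real (Suc i) / real n} h) = integral {0..1} h"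
proof -
  have "(\<Sum>i<m. integral {real i / real n..real (Suc i) / real n} h) = integral {0..real m / real n} h"
    if "m \<le> n" for m
    using that
  proof (induction m)
    case (Suc m)
    have sub: "real (Suc m) / real n \<le> 1" using Suc.prems assms(2) by simp
    have "h integrable_on {0..real (Suc m) / real n}"
      by (rule integrable_subinterval_real[OF assms(1)]) (use sub in auto)
    then have "integral {0..real m / real n} h + integral {real m / real n..real (Suc m) / real n} h
        = integral {0..real (Suc m) / real n} h"
      by (intro Henstock_Kurzweil_Integration.integral_combine) (auto simp: divide_right_mono)
    with Suc show ?case by simp
  qed simp
  from this[of n] assms(2) show ?thesis by simp
qed

lemma decreasing_riemann_sums:
  fixes \<phi> :: "real \<Rightarrow> real"
  assumes "\<phi> integrable_on {0..1}" "n \<ge> 1"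
    and anti: "\<And>x y. 0 \<le> x \<Longrightarrow> x \<le> y \<Longrightarrow> y \<le> 1 \<Longrightarrow> \<phi> y \<le> \<phi> x"
  shows "integral {0..1} \<phi> \<le> 1 / real n * (\<Sum>i<n. \<phi> (real i / real n))"
    and "1 / real n * (\<Sum>i<n. \<phi> (real (Suc i) / real n)) \<le> integral {0..1} \<phi>"
proof -
  have cell: "integral {real i / real n..real (Suc i) / real n} \<phi> \<le> 1 / real n * \<phi> (real i / real n)"
    "1 / real n * \<phi> (real (Suc i) / real n) \<le> integral {real i / real n..real (Suc i) / real n} \<phi>"
    if "i < n" for i
  proof -
    let ?u = "real i / real n" and ?v = "real (Suc i) / real n"
    have uv: "0 \<le> ?u" "?u \<le> ?v" "?v \<le> 1" using that by (auto simp: divide_right_mono)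
    have len: "?v - ?u = 1 / real n" by (simp add: diff_divide_distrib[symmetric])
    have c: "((\<lambda>x. c) has_integral (1 / real n * c)) {?u..?v}" for c :: real
    proof -
      have "((\<lambda>x. c) has_integral ((?v - ?u) * c)) {?u..?v}"
        using has_integral_const_real[of c ?u ?v] uv(2) by simp
      then show ?thesis unfolding len .
    qed
    have "\<phi> integrable_on {?u..?v}"
      by (rule integrable_subinterval_real[OF assms(1)]) (use uv in auto)
    then have int: "(\<phi> has_integral integral {?u..?v} \<phi>) {?u..?v}" by (rule integrable_integral)
    show "integral {?u..?v} \<phi> \<le> 1 / real n * \<phi> ?u"
      by (rule has_integral_le[OF int c]) (intro anti; use uv in \<open>simp only: atLeastAtMost_iff; linarith\<close>)
    show "1 / real n * \<phi> ?v \<le> integral {?u..?v} \<phi>"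
      by (rule has_integral_le[OF c int]) (intro anti; use uv in \<open>simp only: atLeastAtMost_iff; linarith\<close>)
  qed
  show "integral {0..1} \<phi> \<le> 1 / real n * (\<Sum>i<n. \<phi> (real i / real n))"
    unfolding sum_integral_cells[OF assms(1,2), symmetric] sum_distrib_left
    by (intro sum_mono cell) auto
  show "1 / real n * (\<Sum>i<n. \<phi> (real (Suc i) / real n)) \<le> integral {0..1} \<phi>"
    unfolding sum_integral_cells[OF assms(1,2), symmetric] sum_distrib_left
    by (intro sum_mono cell) auto
qed

section \<open>Every admissible path bounds the partition function from below\<close>

text \<open>The energy is convex in the configuration, so it may be replaced by its tangent at any profile
\<open>s\<close> of tail sums (\<open>T\<^sup>2 \<ge> 2 s T - s\<^sup>2\<close>). The tangent is linear in \<open>k\<close>, and the sum over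
configurations factorises over the sites with local fields \<open>\<theta>\<close>.\<close>
lemma partition_sum_ge:
  fixes s :: "nat \<Rightarrow> real"
  assumes "\<rho> > 0" "\<beta> \<ge> 0" "n \<ge> 1"
  defines "\<theta> \<equiv> \<lambda>i. ln \<rho> + 2 * \<beta> / (real n)\<^sup>2 * (\<Sum>j\<in>{1..i}. s j)"
  shows "exp (- (\<beta> / (real n)\<^sup>2) * (\<Sum>j\<in>{1..<n}. (s j)\<^sup>2) - \<beta> * real q) * (\<Prod>i<n. (1 + exp (\<theta> i)) ^ q)
    \<le> partition_sum \<rho> \<beta> q n"
proof -
  let ?K = "{..<n} \<rightarrow>\<^sub>E {..q}"
  define A where "A = - (\<beta> / (real n)\<^sup>2) * (\<Sum>j\<in>{1..<n}. (s j)\<^sup>2) - \<beta> * real q"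
  have "(\<Prod>i<n. (1 + exp (\<theta> i)) ^ q) = (\<Prod>i<n. (exp (\<theta> i) + 1) ^ q)" by (simp add: add.commute)
  also have "\<dots> = (\<Prod>i<n. \<Sum>k\<le>q. real (q choose k) * exp (\<theta> i) ^ k)"
    by (simp add: binomial_ring)
  also have "\<dots> = (\<Sum>k\<in>?K. \<Prod>i<n. real (q choose k i) * exp (\<theta> i) ^ k i)"
    by (subst prod_sum_PiE) auto
  finally have expand: "exp A * (\<Prod>i<n. (1 + exp (\<theta> i)) ^ q)
      = (\<Sum>k\<in>?K. exp A * (\<Prod>i<n. real (q choose k i) * exp (\<theta> i) ^ k i))"
    by (simp add: sum_distrib_left)
  show ?thesis
    unfolding A_def[symmetric] expand partition_sum_def
  proof (rule sum_mono)
    fix k assume k: "k \<in> ?K"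
    define T where "T j = (\<Sum>i\<in>{j..<n}. real (k i))" for j
    have kq: "k i \<le> q" if "i < n" for i using k that by auto
    have T_le: "T j \<le> real q * real n" for j
    proof -
      have "T j \<le> (\<Sum>i\<in>{j..<n}. real q)" unfolding T_def by (intro sum_mono) (use kq in auto)
      also have "\<dots> = real (n - j) * real q" by simp
      also have "\<dots> \<le> real n * real q" by (intro mult_right_mono) auto
      also have "\<dots> = real q * real n" by (rule mult.commute)
      finally show ?thesis .
    qed
    have swap: "(\<Sum>i<n. real (k i) * (\<Sum>j\<in>{1..i}. s j)) = (\<Sum>j\<in>{1..<n}. T j * s j)"
    proof -
      have "(\<Sum>i\<in>{1..j}. s i) - (\<Sum>i\<in>{1..j - 1}. s i) = s j" if "j \<ge> 1" for j
        using that by (cases j) auto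
      then show ?thesis
        unfolding sum_by_parts_tail[of "\<lambda>i. real (k i)" "\<lambda>i. \<Sum>j\<in>{1..i}. s j"] T_def by auto
    qed
    \<comment> \<open>The linear term \<open>- T j\<close> is of lower order: after division by \<open>n\<^sup>2\<close> it costs at most \<open>\<beta> q\<close>.\<close>
    have "(\<Sum>j\<in>{1..<n}. 2 * (T j * s j) - (s j)\<^sup>2 - real q * real n) \<le> (\<Sum>j\<in>{1..<n}. (T j)\<^sup>2 - T j)"
    proof (rule sum_mono)
      fix j
      have "0 \<le> (T j - s j)\<^sup>2" by simp
      then show "2 * (T j * s j) - (s j)\<^sup>2 - real q * real n \<le> (T j)\<^sup>2 - T j"
        using T_le[of j] by (simp add: power2_eq_square algebra_simps)
    qed
    moreover have "(\<Sum>j\<in>{1..<n}. 2 * (T j * s j) - (s j)\<^sup>2 - real q * real n)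
        = 2 * (\<Sum>j\<in>{1..<n}. T j * s j) - (\<Sum>j\<in>{1..<n}. (s j)\<^sup>2) - real (n - 1) * (real q * real n)"
      by (simp add: sum_subtractf sum_distrib_left)
    moreover have "real (n - 1) * (real q * real n) \<le> real n * (real q * real n)"
      by (intro mult_right_mono) auto
    ultimately have "2 * (\<Sum>j\<in>{1..<n}. T j * s j) - (\<Sum>j\<in>{1..<n}. (s j)\<^sup>2) - real q * (real n)\<^sup>2
        \<le> (\<Sum>j\<in>{1..<n}. (T j)\<^sup>2 - T j)"
      by (simp add: power2_eq_square algebra_simps)
    then have "\<beta> / (real n)\<^sup>2 * (2 * (\<Sum>j\<in>{1..<n}. T j * s j) - (\<Sum>j\<in>{1..<n}. (s j)\<^sup>2) - real q * (real n)\<^sup>2)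
        \<le> \<beta> / (real n)\<^sup>2 * (\<Sum>j\<in>{1..<n}. (T j)\<^sup>2 - T j)"
      using assms by (intro mult_left_mono) auto
    moreover have "\<beta> / (real n)\<^sup>2 * (2 * (\<Sum>j\<in>{1..<n}. T j * s j) - (\<Sum>j\<in>{1..<n}. (s j)\<^sup>2) - real q * (real n)\<^sup>2)
        = A + 2 * \<beta> / (real n)\<^sup>2 * (\<Sum>i<n. real (k i) * (\<Sum>j\<in>{1..i}. s j))"
      using assms(3) unfolding swap A_def by (simp add: field_simps)
    ultimately have ineq: "A + 2 * \<beta> / (real n)\<^sup>2 * (\<Sum>i<n. real (k i) * (\<Sum>j\<in>{1..i}. s j))
        \<le> \<beta> / (real n)\<^sup>2 * (\<Sum>j\<in>{1..<n}. (T j)\<^sup>2 - T j)" by simp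
    have "exp (\<theta> i) ^ k i = \<rho> ^ k i * exp (2 * \<beta> / (real n)\<^sup>2 * (real (k i) * (\<Sum>j\<in>{1..i}. s j)))" for i
    proof -
      have "exp (\<theta> i) ^ k i = exp (real (k i) * \<theta> i)"
        by (simp add: exp_of_nat_mult)
      also have "real (k i) * \<theta> i = real (k i) * ln \<rho> + 2 * \<beta> / (real n)\<^sup>2 * (real (k i) * (\<Sum>j\<in>{1..i}. s j))"
        by (simp add: \<theta>_def algebra_simps)
      also have "exp \<dots> = exp (real (k i) * ln \<rho>) * exp (2 * \<beta> / (real n)\<^sup>2 * (real (k i) * (\<Sum>j\<in>{1..i}. s j)))"
        by (rule exp_add)
      also have "exp (real (k i) * ln \<rho>) = \<rho> ^ k i"
        using assms(1) by (simp add: exp_of_nat_mult)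
      finally show ?thesis .
    qed
    then have "exp A * (\<Prod>i<n. real (q choose k i) * exp (\<theta> i) ^ k i)
        = (\<Prod>i<n. real (q choose k i) * \<rho> ^ k i) *
          exp (A + 2 * \<beta> / (real n)\<^sup>2 * (\<Sum>i<n. real (k i) * (\<Sum>j\<in>{1..i}. s j)))"
      by (simp only: prod.distrib exp_add exp_sum sum_distrib_left finite_lessThan) (simp add: mult_ac)
    also have "\<dots> \<le> (\<Prod>i<n. real (q choose k i) * \<rho> ^ k i) * exp (\<beta> / (real n)\<^sup>2 * (\<Sum>j\<in>{1..<n}. (T j)\<^sup>2 - T j))"
      using ineq assms(1) by (intro mult_left_mono prod_nonneg) auto
    finally show "exp A * (\<Prod>i<n. real (q choose k i) * exp (\<theta> i) ^ k i)
      \<le> (\<Prod>i<n. real (q choose k i) * \<rho> ^ k i)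
        * exp (\<beta> / (real n)\<^sup>2 * (\<Sum>j\<in>{1..<n}. (\<Sum>i\<in>{j..<n}. real (k i))\<^sup>2 - (\<Sum>i\<in>{j..<n}. real (k i))))"
      by (simp add: T_def)
  qed
qed

lemma partition_sum_pos:
  assumes "\<rho> > 0"
  shows "partition_sum \<rho> \<beta> q n > 0"
  unfolding partition_sum_def
proof (rule sum_pos)
  show "finite ({..<n} \<rightarrow>\<^sub>E {..q})" by (intro finite_PiE) auto
  show "{..<n} \<rightarrow>\<^sub>E {..q} \<noteq> {}" by (simp add: PiE_eq_empty_iff)
qed (use assms in \<open>auto intro!: mult_pos_pos prod_pos simp: PiE_iff\<close>)

text \<open>Take \<open>s\<close> to be the tail profile of \<open>g\<close> itself. Integrating the Legendre inequality for the
field \<open>\<theta> i\<close> with \<open>y = g' / q\<close> over the \<open>i\<close>-th cell of the grid produces the entropy integral.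
The terms linear in \<open>g\<close> are summed by parts, and the energy integral of the decreasing function \<open>(g 1 - g x)\<^sup>2\<close> is bounded by its left Riemann sum.\<close>
lemma rate_functional_le:
  assumes \<rho>: "\<rho> > 0" and \<beta>: "\<beta> \<ge> 0" and q: "q > 0" and n: "n \<ge> 1" and g: "g \<in> admissible q"
  shows "rate_functional \<rho> \<beta> q g \<le> 1 / real n * ln (partition_sum \<rho> \<beta> q n) + (\<beta> * real q + \<beta> * (real q)\<^sup>2) / real n"
proof -
  define c where "c i = real i / real n" for i
  define d where "d i = g (c (Suc i)) - g (c i)" for i
  define s where "s j = real n * (g 1 - g (c j))" for j
  define \<theta> where "\<theta> i = ln \<rho> + 2 * \<beta> / (real n)\<^sup>2 * (\<Sum>j\<in>{1..i}. s j)" for i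
  have g0: "g 0 = 0" and g1: "0 \<le> g 1" "g 1 \<le> real q"
    using g by (auto simp: admissible_def Pi_iff)
  obtain f N where N: "negligible N" and f0: "\<And>x. 0 \<le> f x" and fq: "\<And>x. f x \<le> real q"
    and fN: "\<And>x. x \<in> {0..1} - N \<Longrightarrow> f x = deriv g x"
    and f_int: "\<And>u v. 0 \<le> u \<Longrightarrow> u \<le> v \<Longrightarrow> v \<le> 1 \<Longrightarrow> (f has_integral (g v - g u)) {u..v}"
    using admissible_density[OF g] by metis
  have p01: "0 \<le> f x / real q" "f x / real q \<le> 1" for x
    using f0 fq q by auto
  \<comment> \<open>If the entropy density were not integrable, its integral would be \<open>0\<close> by convention. Then
    \<open>J = 0\<close> represents it, and still satisfies the Legendre inequality because \<open>I_fun\<close> is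
    nonpositive on the unit interval.\<close>
  define J where "J x = (if (\<lambda>x. I_fun (deriv g x / real q)) integrable_on {0..1} then I_fun (f x / real q) else 0)" for x
  have J: "J integrable_on {0..1} \<and> integral {0..1} J = integral {0..1} (\<lambda>x. I_fun (deriv g x / real q))"
  proof (cases "(\<lambda>x. I_fun (deriv g x / real q)) integrable_on {0..1}")
    case True
    then have "((\<lambda>x. I_fun (deriv g x / real q)) has_integral integral {0..1} (\<lambda>x. I_fun (deriv g x / real q))) {0..1}"
      by (rule integrable_integral)
    then have "(J has_integral integral {0..1} (\<lambda>x. I_fun (deriv g x / real q))) {0..1}"
      by (rule has_integral_spike[OF N, rotated]) (use fN True in \<open>auto simp: J_def\<close>)
    then show ?thesis by (auto simp: has_integral_iff)
  next
    case False
    then have "J = (\<lambda>x. 0)" by (auto simp: J_def)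
    with False show ?thesis by (simp add: not_integrable_integral integrable_0)
  qed
  have legendre: "t * (f x / real q) - J x \<le> ln (1 + exp t)" for t x
  proof -
    have "J x = I_fun (f x / real q) \<or> J x = 0" by (auto simp: J_def)
    moreover have "I_fun (f x / real q) \<le> 0" using I_fun_nonpos[OF p01] .
    ultimately show ?thesis using I_fun_legendre[OF p01[of x], of t] by auto
  qed
  have cell: "\<theta> i * (d i / real q) - integral {c i..c (Suc i)} J \<le> 1 / real n * ln (1 + exp (\<theta> i))" if "i < n" for i
  proof -
    have sub: "0 \<le> c i" "c i \<le> c (Suc i)" "c (Suc i) \<le> 1" using that by (auto simp: c_def divide_right_mono)
    have "J integrable_on {c i..c (Suc i)}"
      by (rule integrable_subinterval_real[OF conjunct1[OF J]]) (use sub in auto)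
    then have a: "((\<lambda>x. \<theta> i * (f x / real q) - J x) has_integral (\<theta> i * (d i / real q) - integral {c i..c (Suc i)} J)) {c i..c (Suc i)}"
      unfolding d_def by (intro has_integral_diff has_integral_mult_right has_integral_divide f_int sub integrable_integral)
    have "c (Suc i) - c i = 1 / real n" by (simp add: c_def diff_divide_distrib[symmetric])
    moreover have "((\<lambda>x. ln (1 + exp (\<theta> i))) has_integral (c (Suc i) - c i) * ln (1 + exp (\<theta> i))) {c i..c (Suc i)}"
      using has_integral_const_real[of "ln (1 + exp (\<theta> i))" "c i" "c (Suc i)"] sub by simp
    ultimately have b: "((\<lambda>x. ln (1 + exp (\<theta> i))) has_integral 1 / real n * ln (1 + exp (\<theta> i))) {c i..c (Suc i)}"
      by simp
    show ?thesis by (rule has_integral_le[OF a b]) (rule legendre)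
  qed
  have entropy: "(\<Sum>i<n. \<theta> i * d i) - real q * integral {0..1} (\<lambda>x. I_fun (deriv g x / real q))
      \<le> real q / real n * (\<Sum>i<n. ln (1 + exp (\<theta> i)))"
  proof -
    have "(\<Sum>i<n. \<theta> i * (d i / real q) - integral {c i..c (Suc i)} J) \<le> (\<Sum>i<n. 1 / real n * ln (1 + exp (\<theta> i)))"
      by (intro sum_mono cell) auto
    moreover have "(\<Sum>i<n. integral {c i..c (Suc i)} J) = integral {0..1} (\<lambda>x. I_fun (deriv g x / real q))"
      using sum_integral_cells[OF conjunct1[OF J] n] J by (simp add: c_def)
    ultimately have "(\<Sum>i<n. \<theta> i * d i) / real q - integral {0..1} (\<lambda>x. I_fun (deriv g x / real q))
        \<le> 1 / real n * (\<Sum>i<n. ln (1 + exp (\<theta> i)))"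
      by (simp add: sum_subtractf sum_divide_distrib[symmetric] sum_distrib_left[symmetric])
    from mult_left_mono[OF this, of "real q"] q show ?thesis by (simp add: algebra_simps)
  qed
  have d_tail: "(\<Sum>i\<in>{j..<n}. d i) = g 1 - g (c j)" if "j \<le> n" for j
  proof -
    have "(\<Sum>i\<in>{j..<n}. d i) = g (c n) - g (c j)"
      unfolding d_def using that by (rule sum_Suc_diff')
    then show ?thesis using n by (simp add: c_def)
  qed
  have abel: "(\<Sum>i<n. \<theta> i * d i) = ln \<rho> * g 1 + 2 * \<beta> / (real n) ^ 3 * (\<Sum>j\<in>{1..<n}. (s j)\<^sup>2)"
  proof -
    have "(\<Sum>i\<in>{1..j}. s i) - (\<Sum>i\<in>{1..j - 1}. s i) = s j" if "j \<ge> 1" for j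
      using that by (cases j) auto
    then have "(\<Sum>i<n. d i * (\<Sum>j\<in>{1..i}. s j)) = (\<Sum>j\<in>{1..<n}. (\<Sum>i\<in>{j..<n}. d i) * s j)"
      unfolding sum_by_parts_tail[of d "\<lambda>i. \<Sum>j\<in>{1..i}. s j"] by auto
    also have "\<dots> = (\<Sum>j\<in>{1..<n}. 1 / real n * (s j)\<^sup>2)"
      using n by (intro sum.cong) (auto simp: d_tail s_def power2_eq_square)
    also have "\<dots> = 1 / real n * (\<Sum>j\<in>{1..<n}. (s j)\<^sup>2)" by (rule sum_distrib_left[symmetric])
    finally have *: "(\<Sum>i<n. d i * (\<Sum>j\<in>{1..i}. s j)) = 1 / real n * (\<Sum>j\<in>{1..<n}. (s j)\<^sup>2)" .
    have "(\<Sum>i<n. d i) = g 1" using d_tail[of 0] g0 by (simp add: c_def atLeast0LessThan)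
    moreover have "(\<Sum>i<n. \<theta> i * d i) = (\<Sum>i<n. ln \<rho> * d i + 2 * \<beta> / (real n)\<^sup>2 * (d i * (\<Sum>j\<in>{1..i}. s j)))"
      by (intro sum.cong) (auto simp: \<theta>_def algebra_simps)
    ultimately show ?thesis
      by (simp only: sum.distrib sum_distrib_left[symmetric] *) (simp add: power2_eq_square power3_eq_cube)
  qed
  have riemann: "integral {0..1} (\<lambda>x. (g 1 - g x)\<^sup>2) \<le> 1 / real n ^ 3 * (\<Sum>j\<in>{1..<n}. (s j)\<^sup>2) + (real q)\<^sup>2 / real n"
  proof -
    have int: "(\<lambda>x. (g 1 - g x)\<^sup>2) integrable_on {0..1}"
      by (intro integrable_continuous_real continuous_intros admissible_continuous[OF g])
    have "integral {0..1} (\<lambda>x. (g 1 - g x)\<^sup>2) \<le> 1 / real n * (\<Sum>i<n. (g 1 - g (real i / real n))\<^sup>2)"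
      using admissible_increment(1)[OF g]
      by (intro decreasing_riemann_sums(1)[OF int n] power_mono) auto
    also have "(\<Sum>i<n. (g 1 - g (real i / real n))\<^sup>2) = (g 1)\<^sup>2 + (\<Sum>j\<in>{1..<n}. (g 1 - g (c j))\<^sup>2)"
      using n g0 by (simp add: lessThan_atLeast0 sum.atLeast_Suc_lessThan c_def)
    also have "(\<Sum>j\<in>{1..<n}. (g 1 - g (c j))\<^sup>2) = 1 / (real n)\<^sup>2 * (\<Sum>j\<in>{1..<n}. (s j)\<^sup>2)"
      using n by (simp add: s_def power_mult_distrib sum_distrib_left[symmetric])
    also have "1 / real n * ((g 1)\<^sup>2 + 1 / (real n)\<^sup>2 * (\<Sum>j\<in>{1..<n}. (s j)\<^sup>2))
        = 1 / real n ^ 3 * (\<Sum>j\<in>{1..<n}. (s j)\<^sup>2) + (g 1)\<^sup>2 / real n"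
      by (simp add: power2_eq_square power3_eq_cube algebra_simps)
    also have "(g 1)\<^sup>2 / real n \<le> (real q)\<^sup>2 / real n"
      using g1 by (intro divide_right_mono power_mono) auto
    finally show ?thesis by simp
  qed
  have pos: "(\<Prod>i<n. (1 + exp (\<theta> i)) ^ q) > 0"
    by (intro prod_pos zero_less_power ballI add_pos_pos) auto
  have ln_exp_mult: "ln (exp x * y) = x + ln y" if "y > 0" for x y :: real
    using that by (simp add: ln_mult)
  have "ln (\<Prod>i<n. (1 + exp (\<theta> i)) ^ q) = real q * (\<Sum>i<n. ln (1 + exp (\<theta> i)))"
  proof -
    have pos1: "1 + exp (\<theta> i) > 0" for i by (simp add: add_pos_pos)
    then have "1 + exp (\<theta> i) \<noteq> 0" for i by (metis less_irrefl)
    with pos1 show ?thesis by (subst ln_prod) (auto simp: ln_realpow sum_distrib_left intro!: sum.cong)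
  qed
  then have "- (\<beta> / (real n)\<^sup>2) * (\<Sum>j\<in>{1..<n}. (s j)\<^sup>2) - \<beta> * real q + real q * (\<Sum>i<n. ln (1 + exp (\<theta> i)))
      = ln (exp (- (\<beta> / (real n)\<^sup>2) * (\<Sum>j\<in>{1..<n}. (s j)\<^sup>2) - \<beta> * real q) * (\<Prod>i<n. (1 + exp (\<theta> i)) ^ q))"
    by (simp only: ln_exp_mult[OF pos])
  also have "\<dots> \<le> ln (partition_sum \<rho> \<beta> q n)"
    using pos partition_sum_ge[OF \<rho> \<beta> n, of s q] partition_sum_pos[OF \<rho>]
    by (subst ln_le_cancel_iff) (auto simp: \<theta>_def)
  finally have "1 / real n * (- (\<beta> / (real n)\<^sup>2) * (\<Sum>j\<in>{1..<n}. (s j)\<^sup>2) - \<beta> * real q + real q * (\<Sum>i<n. ln (1 + exp (\<theta> i))))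
      \<le> 1 / real n * ln (partition_sum \<rho> \<beta> q n)"
    by (intro mult_left_mono) auto
  then have Z: "- \<beta> / real n ^ 3 * (\<Sum>j\<in>{1..<n}. (s j)\<^sup>2) - \<beta> * real q / real n + real q / real n * (\<Sum>i<n. ln (1 + exp (\<theta> i)))
      \<le> 1 / real n * ln (partition_sum \<rho> \<beta> q n)"
    by (simp add: power2_eq_square power3_eq_cube algebra_simps)
  have "\<beta> * integral {0..1} (\<lambda>x. (g 1 - g x)\<^sup>2) \<le> \<beta> * (1 / real n ^ 3 * (\<Sum>j\<in>{1..<n}. (s j)\<^sup>2) + (real q)\<^sup>2 / real n)"
    using riemann \<beta> by (rule mult_left_mono)
  moreover define R where "R = \<beta> / real n ^ 3 * (\<Sum>j\<in>{1..<n}. (s j)\<^sup>2)"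
  moreover have "2 * \<beta> / real n ^ 3 * (\<Sum>j\<in>{1..<n}. (s j)\<^sup>2) = 2 * R"
    and "- \<beta> / real n ^ 3 * (\<Sum>j\<in>{1..<n}. (s j)\<^sup>2) = - R"
    and "\<beta> * (1 / real n ^ 3 * (\<Sum>j\<in>{1..<n}. (s j)\<^sup>2) + (real q)\<^sup>2 / real n) = R + \<beta> * (real q)\<^sup>2 / real n"
    by (simp_all add: R_def distrib_left mult.assoc)
  moreover define P where "P = real q / real n * (\<Sum>i<n. ln (1 + exp (\<theta> i)))"
  moreover define A where "A = integral {0..1} (\<lambda>x. I_fun (deriv g x / real q))"
  ultimately have "ln \<rho> * g 1 + 2 * R - real q * A \<le> P"
      and "- R - \<beta> * real q / real n + P \<le> 1 / real n * ln (partition_sum \<rho> \<beta> q n)"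
      and "\<beta> * integral {0..1} (\<lambda>x. (g 1 - g x)\<^sup>2) \<le> R + \<beta> * (real q)\<^sup>2 / real n"
    using entropy Z unfolding abel by simp_all
  then show ?thesis
    unfolding rate_functional_def A_def[symmetric] add_divide_distrib mult.commute[of "g 1"] by linarith
qed

text \<open>The lower bound for a single \<open>n\<close>, read as an upper bound for the functional.\<close>
lemma bdd_above_rate_functional:
  assumes "\<rho> > 0" "\<beta> \<ge> 0" "q > 0"
  shows "bdd_above (rate_functional \<rho> \<beta> q ` admissible q)"
  using rate_functional_le[OF assms, of 1] by (intro bdd_aboveI2) auto

section \<open>Piecewise linear paths\<close>

text \<open>The continuous function with value \<open>0\<close> at \<open>0\<close> and slope \<open>s i\<close> on the \<open>i\<close>-th cell of the grid of
mesh \<open>1 / n\<close>. Each summand is a ramp over one cell, which makes the Lipschitz bound immediate.\<close>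
definition polygon :: "nat \<Rightarrow> (nat \<Rightarrow> real) \<Rightarrow> real \<Rightarrow> real" where
  "polygon n s x = (\<Sum>i<n. s i * max 0 (min (1 / real n) (x - real i / real n)))"

lemma polygon_on_cell:
  assumes "i < n" "real i / real n \<le> y" "y \<le> real (Suc i) / real n"
  shows "polygon n s y = 1 / real n * (\<Sum>l<i. s l) + s i * (y - real i / real n)"
proof -
  have n: "real n > 0" using assms by simp
  have yn: "real i \<le> y * real n" "y * real n \<le> real i + 1" using assms n by (auto simp: field_simps)
  have "polygon n s y = (\<Sum>l<Suc i. s l * max 0 (min (1 / real n) (y - real l / real n)))"
    unfolding polygon_def
  proof (rule sum.mono_neutral_right)
    show "\<forall>l\<in>{..<n} - {..<Suc i}. s l * max 0 (min (1 / real n) (y - real l / real n)) = 0"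
    proof
      fix l assume "l \<in> {..<n} - {..<Suc i}"
      then have "real i + 1 \<le> real l" by auto
      with yn have "y - real l / real n \<le> 0" using n by (simp add: field_simps)
      then show "s l * max 0 (min (1 / real n) (y - real l / real n)) = 0" by auto
    qed
  qed (use assms in auto)
  also have "\<dots> = (\<Sum>l<i. s l * max 0 (min (1 / real n) (y - real l / real n))) + s i * (y - real i / real n)"
  proof -
    have "y - real i / real n = (y * real n - real i) / real n" using n by (simp add: diff_divide_distrib)
    moreover have "(y * real n - real i) / real n \<le> 1 / real n" "0 \<le> (y * real n - real i) / real n"
      using yn n by (auto intro!: divide_right_mono)
    ultimately have "y - real i / real n \<le> 1 / real n" "0 \<le> y - real i / real n" by simp_all
    then show ?thesis by (simp add: max_def min_def)
  qed
  also have "(\<Sum>l<i. s l * max 0 (min (1 / real n) (y - real l / real n))) = (\<Sum>l<i. 1 / real n * s l)"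
  proof (rule sum.cong)
    fix l assume "l \<in> {..<i}"
    then have "real l + 1 \<le> real i" by auto
    with yn have "1 / real n \<le> y - real l / real n" using n by (simp add: field_simps)
    then show "s l * max 0 (min (1 / real n) (y - real l / real n)) = 1 / real n * s l" using n by simp
  qed simp
  finally show ?thesis by (simp add: sum_distrib_left)
qed

lemma polygon_grid:
  assumes "j \<le> n" "n \<ge> 1"
  shows "polygon n s (real j / real n) = 1 / real n * (\<Sum>i<j. s i)"
proof (cases "j < n")
  case True
  then show ?thesis by (subst polygon_on_cell[of j]) (auto simp: divide_right_mono)
next
  case False
  with assms have "j = Suc (n - 1)" by simp
  then obtain m where m: "n = Suc m" "j = Suc m" using False assms by (cases n) auto
  have "real (Suc m) / real (Suc m) - real m / real (Suc m) = 1 / real (Suc m)"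
    unfolding diff_divide_distrib[symmetric] by simp
  then have "polygon (Suc m) s (real (Suc m) / real (Suc m)) = 1 / real (Suc m) * (\<Sum>l<m. s l) + s m * (1 / real (Suc m))"
    by (subst polygon_on_cell[of m]) (auto simp only: divide_right_mono of_nat_le_iff of_nat_0_le_iff lessI le_SucI order_refl)
  then show ?thesis unfolding m by (simp add: distrib_left add.commute del: of_nat_Suc)
qed

lemma polygon_deriv:
  assumes "i < n" "x \<in> {real i / real n<..<real (Suc i) / real n}"
  shows "(polygon n s has_real_derivative s i) (at x)"
proof (rule has_field_derivative_transform_within_open)
  show "((\<lambda>y. 1 / real n * (\<Sum>l<i. s l) + s i * (y - real i / real n)) has_real_derivative s i) (at x)"
    by (auto intro!: derivative_eq_intros)
  show "open {real i / real n<..<real (Suc i) / real n}" by simp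
  show "x \<in> {real i / real n<..<real (Suc i) / real n}" by (rule assms)
qed (use assms(1) in \<open>auto simp: polygon_on_cell\<close>)

lemma polygon_admissible:
  assumes n: "n \<ge> 1" and s: "\<And>i. i < n \<Longrightarrow> 0 \<le> s i \<and> s i \<le> real q"
  shows "polygon n s \<in> admissible q"
proof -
  define S where "S = (\<Sum>i<n. s i)"
  have S: "S \<ge> 0" unfolding S_def by (intro sum_nonneg) (use s in auto)
  have lip: "\<bar>polygon n s v - polygon n s u\<bar> \<le> S * (v - u)" if "u \<le> v" for u v
  proof -
    have "\<bar>polygon n s v - polygon n s u\<bar> \<le> (\<Sum>i<n. \<bar>s i * max 0 (min (1 / real n) (v - real i / real n))
        - s i * max 0 (min (1 / real n) (u - real i / real n))\<bar>)"
      unfolding polygon_def sum_subtractf[symmetric] by (rule sum_abs)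
    also have "\<dots> \<le> (\<Sum>i<n. s i * (v - u))"
    proof (rule sum_mono)
      fix i assume "i \<in> {..<n}"
      have "\<bar>max 0 (min (1 / real n) (v - real i / real n)) - max 0 (min (1 / real n) (u - real i / real n))\<bar> \<le> v - u"
        using that by (auto simp: max_def min_def)
      with s[of i] \<open>i \<in> {..<n}\<close> show "\<bar>s i * max 0 (min (1 / real n) (v - real i / real n))
        - s i * max 0 (min (1 / real n) (u - real i / real n))\<bar> \<le> s i * (v - u)"
        by (simp add: right_diff_distrib[symmetric] abs_mult mult_left_mono del: right_diff_distrib)
    qed
    finally show ?thesis by (simp add: S_def sum_distrib_right)
  qed
  have range: "polygon n s x \<in> {0..real q}" for x
  proof -
    have "polygon n s x \<le> (\<Sum>i<n. real q * (1 / real n))"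
      unfolding polygon_def using s by (intro sum_mono mult_mono) auto
    also have "\<dots> = real q" using n by simp
    finally show ?thesis using s by (auto simp: polygon_def intro!: sum_nonneg)
  qed
  have AC: "abs_continuous_on_Icc 0 1 (polygon n s)"
    unfolding abs_continuous_on_Icc_def
  proof (intro allI impI)
    fix \<epsilon> :: real assume "\<epsilon> > 0"
    show "\<exists>\<delta>>0. \<forall>D. finite D \<and> (\<forall>(u, v)\<in>D. 0 \<le> u \<and> u \<le> v \<and> v \<le> 1) \<and>
        pairwise (\<lambda>(u, v) (u', v'). {u<..<v} \<inter> {u'<..<v'} = {}) D \<and>
        (\<Sum>(u, v)\<in>D. v - u) < \<delta> \<longrightarrow> (\<Sum>(u, v)\<in>D. \<bar>polygon n s v - polygon n s u\<bar>) < \<epsilon>"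
    proof (intro exI[of _ "\<epsilon> / (S + 1)"] conjI allI impI; (elim conjE)?)
      show "0 < \<epsilon> / (S + 1)" using \<open>\<epsilon> > 0\<close> S by simp
      fix D :: "(real \<times> real) set"
      assume D: "\<forall>(u, v)\<in>D. 0 \<le> u \<and> u \<le> v \<and> v \<le> 1" "(\<Sum>(u, v)\<in>D. v - u) < \<epsilon> / (S + 1)"
      have "(\<Sum>(u, v)\<in>D. \<bar>polygon n s v - polygon n s u\<bar>) \<le> (\<Sum>z\<in>D. S * (case z of (u, v) \<Rightarrow> v - u))"
        using D(1) lip by (intro sum_mono) fastforce
      also have "\<dots> = S * (\<Sum>(u, v)\<in>D. v - u)" by (simp add: sum_distrib_left)
      also have "\<dots> \<le> S * (\<epsilon> / (S + 1))" using D(2) S by (intro mult_left_mono) auto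
      also have "\<dots> < \<epsilon>" using S \<open>\<epsilon> > 0\<close> by (simp add: field_simps)
      finally show "(\<Sum>(u, v)\<in>D. \<bar>polygon n s v - polygon n s u\<bar>) < \<epsilon>" .
    qed
  qed
  have "AE x in lborel. x \<notin> (\<lambda>i. real i / real n) ` {..n}"
    by (rule AE_not_in[OF finite_imp_null_set_lborel]) simp
  then have ae: "AE x in lborel. x \<in> {0..1} \<longrightarrow> polygon n s differentiable (at x)
      \<and> 0 \<le> deriv (polygon n s) x \<and> deriv (polygon n s) x \<le> real q"
  proof (eventually_elim, intro impI)
    fix x :: real assume nx: "x \<notin> (\<lambda>i. real i / real n) ` {..n}" and x: "x \<in> {0..1}"
    define i where "i = nat \<lfloor>x * real n\<rfloor>"
    have i: "real i \<le> x * real n" "x * real n < real i + 1"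
      using x by (auto simp: i_def)
    have "x * real n \<le> real n" using x n by (simp add: mult_le_cancel_right2)
    then have "i \<le> n" using i by linarith
    with nx have "x \<noteq> real i / real n" by auto
    moreover have "x \<noteq> real n / real n" using nx by blast
    ultimately have ne: "x * real n \<noteq> real i" "x \<noteq> 1" using n by (auto simp: eq_divide_eq)
    then have "x < 1" using x by auto
    then have "x * real n < real n" using n by simp
    then have "i < n" using i by linarith
    moreover have "x \<in> {real i / real n<..<real (Suc i) / real n}"
      using i ne(1) n by (auto simp: field_simps)
    ultimately have "(polygon n s has_real_derivative s i) (at x)" by (rule polygon_deriv)
    then show "polygon n s differentiable (at x) \<and> 0 \<le> deriv (polygon n s) x \<and> deriv (polygon n s) x \<le> real q"
      using s[OF \<open>i < n\<close>] by (auto simp: DERIV_imp_deriv real_differentiable_def)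
  qed
  have "polygon n s 0 = 0" using polygon_grid[of 0 n s] n by simp
  with range AC ae show ?thesis by (auto simp: admissible_def)
qed

text \<open>The bracket is the exponent that coarse-graining will produce for slopes \<open>s\<close>. It is an exact
expression for all parts of the functional except the energy, where a right Riemann sum of a
decreasing function stands for the integral.\<close>
lemma rate_functional_polygon_ge:
  assumes \<beta>: "\<beta> \<ge> 0" and n: "n \<ge> 1" and s: "\<And>i. i < n \<Longrightarrow> 0 \<le> s i \<and> s i \<le> real q"
  shows "1 / real n * (ln \<rho> * (\<Sum>i<n. s i) + \<beta> / (real n)\<^sup>2 * (\<Sum>j\<in>{1..<n}. (\<Sum>i\<in>{j..<n}. s i)\<^sup>2)
      - real q * (\<Sum>i<n. I_fun (s i / real q))) \<le> rate_functional \<rho> \<beta> q (polygon n s)"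
proof -
  let ?g = "polygon n s"
  note adm = polygon_admissible[OF n s]
  have g1: "?g 1 = 1 / real n * (\<Sum>i<n. s i)" using polygon_grid[of n n s] n by simp
  have entropy: "((\<lambda>x. I_fun (deriv ?g x / real q)) has_integral 1 / real n * (\<Sum>i<m. I_fun (s i / real q))) {0..real m / real n}"
    if "m \<le> n" for m using that
  proof (induction m)
    case (Suc m)
    let ?u = "real m / real n" and ?v = "real (Suc m) / real n"
    have "?u \<le> ?v" by (simp add: divide_right_mono)
    have "?v - ?u = 1 / real n" by (simp add: diff_divide_distrib[symmetric])
    moreover have "((\<lambda>x. I_fun (s m / real q)) has_integral (?v - ?u) * I_fun (s m / real q)) {?u..?v}"
      using has_integral_const_real[of "I_fun (s m / real q)" ?u ?v] \<open>?u \<le> ?v\<close> by simp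
    ultimately have "((\<lambda>x. I_fun (s m / real q)) has_integral 1 / real n * I_fun (s m / real q)) (cbox ?u ?v)"
      by simp
    then have "((\<lambda>x. I_fun (deriv ?g x / real q)) has_integral 1 / real n * I_fun (s m / real q)) (cbox ?u ?v)"
    proof (rule has_integral_spike_interior)
      fix x assume "x \<in> box ?u ?v"
      with Suc.prems have "(?g has_real_derivative s m) (at x)" by (intro polygon_deriv) auto
      then show "I_fun (deriv ?g x / real q) = I_fun (s m / real q)" by (simp add: DERIV_imp_deriv)
    qed
    then have "((\<lambda>x. I_fun (deriv ?g x / real q)) has_integral
        1 / real n * (\<Sum>i<m. I_fun (s i / real q)) + 1 / real n * I_fun (s m / real q)) {0..?v}"
      using Suc \<open>?u \<le> ?v\<close> by (intro has_integral_combine[of 0 ?u ?v]) auto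
    then show ?case by (simp add: algebra_simps)
  qed (simp add: has_integral_refl)
  have int_I: "integral {0..1} (\<lambda>x. I_fun (deriv ?g x / real q)) = 1 / real n * (\<Sum>i<n. I_fun (s i / real q))"
    using entropy[of n] n by (simp add: integral_unique)
  have "1 / real n * (\<Sum>i<n. (?g 1 - ?g (real (Suc i) / real n))\<^sup>2) \<le> integral {0..1} (\<lambda>x. (?g 1 - ?g x)\<^sup>2)"
  proof (rule decreasing_riemann_sums(2))
    show "(\<lambda>x. (?g 1 - ?g x)\<^sup>2) integrable_on {0..1}"
      by (intro integrable_continuous_real continuous_intros admissible_continuous[OF adm])
    show "(?g 1 - ?g y)\<^sup>2 \<le> (?g 1 - ?g x)\<^sup>2" if "0 \<le> x" "x \<le> y" "y \<le> 1" for x y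
      using admissible_increment(1)[OF adm] that by (intro power_mono) auto
  qed (rule n)
  also have "(\<Sum>i<n. (?g 1 - ?g (real (Suc i) / real n))\<^sup>2) = (\<Sum>j\<in>{1..n}. (?g 1 - ?g (real j / real n))\<^sup>2)"
    by (rule sum.reindex_bij_witness[of _ "\<lambda>j. j - 1" Suc]) auto
  also have "\<dots> = (\<Sum>j\<in>{1..<n}. (?g 1 - ?g (real j / real n))\<^sup>2)"
    by (rule sum.mono_neutral_right) (auto simp: not_less)
  also have "\<dots> = (\<Sum>j\<in>{1..<n}. 1 / (real n)\<^sup>2 * (\<Sum>i\<in>{j..<n}. s i)\<^sup>2)"
  proof (rule sum.cong)
    fix j assume j: "j \<in> {1..<n}"
    have "(\<Sum>i<n. s i) = (\<Sum>i<j. s i) + (\<Sum>i\<in>{j..<n}. s i)"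
      using j by (subst sum.union_disjoint[symmetric]) (auto intro!: sum.cong)
    then have "?g 1 - ?g (real j / real n) = 1 / real n * (\<Sum>i\<in>{j..<n}. s i)"
      using j unfolding g1 by (subst polygon_grid) (auto simp: algebra_simps)
    then show "(?g 1 - ?g (real j / real n))\<^sup>2 = 1 / (real n)\<^sup>2 * (\<Sum>i\<in>{j..<n}. s i)\<^sup>2"
      by (simp only: power_mult_distrib power_one_over)
  qed simp
  also have "\<dots> = 1 / (real n)\<^sup>2 * (\<Sum>j\<in>{1..<n}. (\<Sum>i\<in>{j..<n}. s i)\<^sup>2)" by (rule sum_distrib_left[symmetric])
  finally have "\<beta> * (1 / real n * (1 / (real n)\<^sup>2 * (\<Sum>j\<in>{1..<n}. (\<Sum>i\<in>{j..<n}. s i)\<^sup>2)))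
      \<le> \<beta> * integral {0..1} (\<lambda>x. (?g 1 - ?g x)\<^sup>2)"
    using \<beta> by (intro mult_left_mono)
  then show ?thesis
    unfolding rate_functional_def int_I g1 by (simp add: algebra_simps)
qed

section \<open>Coarse-graining bounds the partition function from above\<close>

definition block :: "nat \<Rightarrow> nat \<Rightarrow> nat \<Rightarrow> nat set" where
  "block L n b = {l \<in> {..<n}. l div L = b}"

text \<open>Averages of a configuration over consecutive blocks of \<open>L\<close> sites; the last block may be shorter.
The value \<open>0\<close> beyond \<open>n\<close> lets equality of functions express that two configurations have the same
averages.\<close>
definition block_avg :: "nat \<Rightarrow> nat \<Rightarrow> (nat \<Rightarrow> nat) \<Rightarrow> nat \<Rightarrow> real" where
  "block_avg L n k i =
     (if i < n then (\<Sum>l\<in>block L n (i div L). real (k l)) / real (card (block L n (i div L))) else 0)"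

lemma finite_block [simp]: "finite (block L n b)"
  by (simp add: block_def)

lemma card_block_pos: "i < n \<Longrightarrow> 0 < card (block L n (i div L))"
  by (auto simp: card_gt_0_iff block_def)

lemma card_block_le:
  assumes "L \<ge> 1"
  shows "card (block L n b) \<le> L"
proof -
  have "block L n b \<subseteq> {b * L..<b * L + L}"
    using assms by (auto simp: block_def) (metis add.commute dividend_less_div_times less_eq_Suc_le less_le_trans One_nat_def)
  then have "card (block L n b) \<le> card {b * L..<b * L + L}" by (rule card_mono[rotated]) simp
  then show ?thesis by simp
qed

text \<open>Averaging is invisible to weights that are constant on blocks.\<close>
lemma sum_block_avg:
  "(\<Sum>i<n. block_avg L n k i * \<phi> (i div L)) = (\<Sum>i<n. real (k i) * \<phi> (i div L))"
proof -
  have "(\<Sum>i\<in>{i \<in> {..<n}. i div L = b}. block_avg L n k i * \<phi> (i div L))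
      = (\<Sum>i\<in>{i \<in> {..<n}. i div L = b}. real (k i) * \<phi> (i div L))"
    if b: "b \<in> (\<lambda>i. i div L) ` {..<n}" for b
  proof -
    have c: "real (card (block L n b)) \<noteq> 0" using b card_block_pos[of _ n L] by force
    have "(\<Sum>i\<in>{i \<in> {..<n}. i div L = b}. block_avg L n k i * \<phi> (i div L))
        = (\<Sum>i\<in>block L n b. (\<Sum>l\<in>block L n b. real (k l)) / real (card (block L n b)) * \<phi> b)"
      by (rule sum.cong) (auto simp: block_def block_avg_def)
    also have "\<dots> = (\<Sum>l\<in>block L n b. real (k l)) * \<phi> b" using c by simp
    also have "\<dots> = (\<Sum>i\<in>{i \<in> {..<n}. i div L = b}. real (k i) * \<phi> (i div L))"
      unfolding sum_distrib_right by (rule sum.cong) (auto simp: block_def)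
    finally show ?thesis .
  qed
  then show ?thesis
    by (simp add: sum.image_gen[of "{..<n}" _ "\<lambda>i. i div L"] cong: sum.cong)
qed

lemma block_avg_bounds:
  assumes "\<And>i. i < n \<Longrightarrow> k i \<le> q"
  shows "0 \<le> block_avg L n k i" "block_avg L n k i \<le> real q"
proof -
  show "0 \<le> block_avg L n k i" by (auto simp: block_avg_def intro!: divide_nonneg_nonneg sum_nonneg)
  show "block_avg L n k i \<le> real q"
  proof (cases "i < n")
    case True
    have "(\<Sum>l\<in>block L n (i div L). real (k l)) \<le> (\<Sum>l\<in>block L n (i div L). real q)"
      using assms by (intro sum_mono) (auto simp: block_def)
    with True card_block_pos[OF True, of L] show ?thesis
      by (simp add: block_avg_def pos_divide_le_eq mult.commute)
  qed (simp add: block_avg_def)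
qed

lemma block_avg_extreme:
  assumes i: "i < n"
  shows "block_avg L n k i = 0 \<Longrightarrow> k i = 0"
    and "block_avg L n k i = real q \<Longrightarrow> (\<And>l. l < n \<Longrightarrow> k l \<le> q) \<Longrightarrow> k i = q"
proof -
  let ?B = "block L n (i div L)"
  have iB: "i \<in> ?B" using i by (simp add: block_def)
  have c: "real (card ?B) > 0" using card_block_pos[OF i] by simp
  show "k i = 0" if "block_avg L n k i = 0"
  proof -
    have "(\<Sum>l\<in>?B. real (k l)) = 0" using that i c by (auto simp: block_avg_def)
    then show ?thesis using iB by (subst (asm) sum_nonneg_eq_0_iff) auto
  qed
  show "k i = q" if "block_avg L n k i = real q" and le: "\<And>l. l < n \<Longrightarrow> k l \<le> q"
  proof -
    have "(\<Sum>l\<in>?B. real (k l)) = real q * real (card ?B)"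
      using that(1) i c by (auto simp: block_avg_def divide_eq_eq split: if_splits)
    then have "(\<Sum>l\<in>?B. real q - real (k l)) = 0" by (simp add: sum_subtractf)
    moreover have "\<forall>l\<in>?B. 0 \<le> real q - real (k l)" using le by (auto simp: block_def)
    ultimately have "real q - real (k i) = 0" using iB by (subst (asm) sum_nonneg_eq_0_iff) auto
    then show ?thesis by simp
  qed
qed

lemma block_avg_start:
  assumes "i < n"
  shows "block_avg L n k (i div L * L) = block_avg L n k i"
proof (cases "L = 0")
  case False
  have "i div L * L \<le> i" by simp
  with assms have "i div L * L < n" by linarith
  with assms False show ?thesis by (simp add: block_avg_def)
qed (use assms in \<open>auto simp: block_avg_def\<close>)

text \<open>The tail sums of \<open>k\<close> and of its averages agree at the block boundaries, so they differ by at most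
the contribution of a single block.\<close>
lemma block_avg_tail:
  assumes L: "L \<ge> 1" and le: "\<And>i. i < n \<Longrightarrow> k i \<le> q"
  shows "\<bar>(\<Sum>i\<in>{j..<n}. real (k i)) - (\<Sum>i\<in>{j..<n}. block_avg L n k i)\<bar> \<le> real q * real L"
proof -
  define D where "D i = real (k i) - block_avg L n k i" for i
  define A where "A = {i \<in> {..<n}. i div L > j div L}"
  define B where "B = {i \<in> {j..<n}. i div L = j div L}"
  have D: "\<bar>D i\<bar> \<le> real q" if "i < n" for i
    using block_avg_bounds[of n k q L i] le that by (force simp: D_def)
  have "(\<Sum>i\<in>A. D i) = (\<Sum>i<n. D i * (if i div L > j div L then 1 else 0))"
    unfolding A_def by (rule sum.mono_neutral_cong_left) auto
  also have "\<dots> = 0"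
    using sum_block_avg[of L n k "\<lambda>b. if b > j div L then 1 else 0"]
    by (simp add: D_def left_diff_distrib sum_subtractf)
  finally have A0: "(\<Sum>i\<in>A. D i) = 0" .
  have "{j..<n} = A \<union> B"
    using div_le_mono[of j _ L] by (auto simp: A_def B_def le_less)
      (metis div_le_mono not_le not_less_iff_gr_or_eq order.asym)+
  moreover have "A \<inter> B = {}" "finite A" "finite B" by (auto simp: A_def B_def)
  ultimately have "(\<Sum>i\<in>{j..<n}. D i) = (\<Sum>i\<in>A. D i) + (\<Sum>i\<in>B. D i)"
    by (simp add: sum.union_disjoint)
  then have "\<bar>\<Sum>i\<in>{j..<n}. D i\<bar> \<le> (\<Sum>i\<in>B. \<bar>D i\<bar>)"
    using A0 by (simp add: sum_abs)
  also have "\<dots> \<le> (\<Sum>i\<in>B. real q)"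
    by (intro sum_mono D) (auto simp: B_def)
  also have "\<dots> = real q * real (card B)" by simp
  also have "\<dots> \<le> real q * real L"
  proof -
    have "card B \<le> card (block L n (j div L))" by (rule card_mono) (auto simp: B_def block_def)
    with card_block_le[OF L, of n "j div L"] show ?thesis by (intro mult_left_mono) auto
  qed
  finally show ?thesis by (simp add: D_def sum_subtractf)
qed

text \<open>An entropy bound without Stirling's formula. Under independent binomial variables with success
probabilities \<open>p i = a i / q\<close>, every configuration of the class has probability
\<open>(\<Prod>i. q choose k i) * exp (q * (\<Sum>i. I_fun (p i)))\<close>, because \<open>p\<close> is constant on blocks; and the
probabilities sum to at most \<open>1\<close>.\<close>
lemma block_class_weight_le:
  fixes a :: "nat \<Rightarrow> real"
  assumes q: "q > 0" and L: "L \<ge> 1" and a: "\<And>i. i < n \<Longrightarrow> 0 \<le> a i \<and> a i \<le> real q"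
  shows "(\<Sum>k\<in>{k \<in> {..<n} \<rightarrow>\<^sub>E {..q}. block_avg L n k = a}. \<Prod>i<n. real (q choose k i))
     \<le> exp (- real q * (\<Sum>i<n. I_fun (a i / real q)))"
proof -
  let ?K = "{..<n} \<rightarrow>\<^sub>E {..q}"
  define p where "p i = a i / real q" for i
  have p: "0 \<le> p i" "p i \<le> 1" if "i < n" for i using a[OF that] q by (auto simp: p_def)
  have aq: "a i = real q * p i" for i using q by (simp add: p_def)
  have const: "(\<Prod>i<n. p i ^ k i * (1 - p i) ^ (q - k i)) = exp (real q * (\<Sum>i<n. I_fun (p i)))"
    if k: "k \<in> ?K" and ka: "block_avg L n k = a" for k
  proof -
    have kq: "k i \<le> q" if "i < n" for i using k that by auto
    \<comment> \<open>Where \<open>p i\<close> is \<open>0\<close> or \<open>1\<close>, the exponent of the vanishing base is \<open>0\<close>.\<close>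
    have *: "p i ^ k i * (1 - p i) ^ (q - k i) = exp (real (k i) * ln (p i) + (real q - real (k i)) * ln (1 - p i))"
      if i: "i < n" for i
    proof -
      have "p i ^ k i = exp (real (k i) * ln (p i))"
      proof (cases "p i = 0")
        case True
        then have "k i = 0" using block_avg_extreme(1)[OF i, of L k] ka by (simp add: aq)
        then show ?thesis by simp
      qed (use p[OF i] in \<open>auto simp: exp_of_nat_mult\<close>)
      moreover have "(1 - p i) ^ (q - k i) = exp (real (q - k i) * ln (1 - p i))"
      proof (cases "p i = 1")
        case True
        then have "k i = q" using block_avg_extreme(2)[OF i, of L k q] ka kq by (simp add: aq)
        then show ?thesis by simp
      next
        case False
        with p[OF i] have "1 - p i > 0" by simp
        then show ?thesis by (simp only: exp_of_nat_mult exp_ln)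
      qed
      ultimately show ?thesis using kq[OF i] by (simp add: exp_add of_nat_diff)
    qed
    have avg: "(\<Sum>i<n. real (k i) * f (p i)) = (\<Sum>i<n. a i * f (p i))" for f :: "real \<Rightarrow> real"
    proof -
      have "p i = block_avg L n k (i div L * L) / real q" if "i < n" for i
        using block_avg_start[OF that, of L k] ka by (simp add: p_def)
      then show ?thesis
        using sum_block_avg[of L n k "\<lambda>b. f (block_avg L n k (b * L) / real q)"] ka by simp
    qed
    have "(\<Sum>i<n. real (k i) * ln (p i) + (real q - real (k i)) * ln (1 - p i))
        = (\<Sum>i<n. a i * ln (p i) + (real q - a i) * ln (1 - p i))"
      using avg[of ln] avg[of "\<lambda>x. ln (1 - x)"] by (simp add: sum.distrib sum_subtractf left_diff_distrib)
    also have "\<dots> = real q * (\<Sum>i<n. I_fun (p i))"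
      unfolding sum_distrib_left by (intro sum.cong) (auto simp: aq I_fun_def algebra_simps)
    finally have "(\<Sum>i<n. real (k i) * ln (p i) + (real q - real (k i)) * ln (1 - p i)) = real q * (\<Sum>i<n. I_fun (p i))" .
    moreover have "(\<Prod>i<n. p i ^ k i * (1 - p i) ^ (q - k i))
        = exp (\<Sum>i<n. real (k i) * ln (p i) + (real q - real (k i)) * ln (1 - p i))"
      by (subst exp_sum) (auto simp: * intro!: prod.cong)
    ultimately show ?thesis by simp
  qed
  have "exp (real q * (\<Sum>i<n. I_fun (p i))) * (\<Sum>k\<in>{k \<in> ?K. block_avg L n k = a}. \<Prod>i<n. real (q choose k i))
      = (\<Sum>k\<in>{k \<in> ?K. block_avg L n k = a}. exp (real q * (\<Sum>i<n. I_fun (p i))) * (\<Prod>i<n. real (q choose k i)))"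
    by (rule sum_distrib_left)
  also have "\<dots> = (\<Sum>k\<in>{k \<in> ?K. block_avg L n k = a}. \<Prod>i<n. real (q choose k i) * (p i ^ k i * (1 - p i) ^ (q - k i)))"
  proof (intro sum.cong refl)
    fix k assume "k \<in> {k \<in> ?K. block_avg L n k = a}"
    then have "(\<Prod>i<n. real (q choose k i) * (p i ^ k i * (1 - p i) ^ (q - k i)))
        = (\<Prod>i<n. real (q choose k i)) * exp (real q * (\<Sum>i<n. I_fun (p i)))"
      unfolding prod.distrib[of "\<lambda>i. real (q choose k i)"] by (simp only: mem_Collect_eq const)
    then show "exp (real q * (\<Sum>i<n. I_fun (p i))) * (\<Prod>i<n. real (q choose k i))
        = (\<Prod>i<n. real (q choose k i) * (p i ^ k i * (1 - p i) ^ (q - k i)))"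
      by (simp only: mult.commute)
  qed
  also have "\<dots> \<le> (\<Sum>k\<in>?K. \<Prod>i<n. real (q choose k i) * (p i ^ k i * (1 - p i) ^ (q - k i)))"
    using p by (intro sum_mono2 prod_nonneg ballI mult_nonneg_nonneg zero_le_power) (auto intro!: finite_PiE)
  also have "\<dots> = (\<Prod>i<n. \<Sum>k\<le>q. real (q choose k) * (p i ^ k * (1 - p i) ^ (q - k)))"
    by (subst prod_sum_PiE) auto
  also have "\<dots> = (\<Prod>i<n. (p i + (1 - p i)) ^ q)"
    by (simp only: binomial_ring mult.assoc)
  also have "\<dots> = 1" by simp
  finally show ?thesis
    by (simp add: p_def[symmetric] exp_minus field_simps)
qed

text \<open>The averages are determined by the \<open>n div L + 1\<close> block sums, each at most \<open>q * n\<close>.\<close>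
lemma card_block_avg_le:
  "card (block_avg L n ` ({..<n} \<rightarrow>\<^sub>E {..q})) \<le> (q * n + 1) ^ (n div L + 1)"
proof -
  let ?K = "{..<n} \<rightarrow>\<^sub>E {..q}" and ?R = "{..<n div L + 1} \<rightarrow>\<^sub>E {..q * n}"
  define S where "S k = (\<lambda>b\<in>{..<n div L + 1}. \<Sum>l\<in>block L n b. k l)" for k :: "nat \<Rightarrow> nat"
  define F where "F r i = (if i < n then real (r (i div L)) / real (card (block L n (i div L))) else 0)"
    for r :: "nat \<Rightarrow> nat" and i
  have "block_avg L n k = F (S k)" for k
    using div_le_mono[of _ n L] by (auto simp: fun_eq_iff block_avg_def F_def S_def less_Suc_eq_le)
  then have eq: "block_avg L n ` ?K = F ` (S ` ?K)" by (simp add: image_image)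
  have "S ` ?K \<subseteq> ?R"
  proof (clarsimp simp: S_def PiE_iff)
    fix k :: "nat \<Rightarrow> nat" and b assume k: "\<forall>i\<in>{..<n}. k i \<le> q"
    have "(\<Sum>l\<in>block L n b. k l) \<le> (\<Sum>l\<in>block L n b. q)"
      using k by (intro sum_mono) (auto simp: block_def)
    also have "\<dots> \<le> q * n"
      using card_mono[of "{..<n}" "block L n b"] by (auto simp: block_def)
    finally show "(\<Sum>l\<in>block L n b. k l) \<le> q * n" .
  qed
  then have "block_avg L n ` ?K \<subseteq> F ` ?R" unfolding eq by (rule image_mono)
  then have "card (block_avg L n ` ?K) \<le> card (F ` ?R)"
    by (intro card_mono finite_imageI finite_PiE) auto
  also have "\<dots> \<le> card ?R" by (intro card_image_le finite_PiE) auto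
  also have "\<dots> = (q * n + 1) ^ (n div L + 1)" by (simp add: card_PiE)
  finally show ?thesis .
qed

text \<open>Within a class of configurations with the same block averages \<open>a\<close>, the weight \<open>\<rho> ^ k i\<close> and, up to
an error of order \<open>L / n\<close> per site, the energy depend on \<open>a\<close> only. So each class contributes at
most \<open>exp B\<close> up to that error, and the number of classes is subexponential when \<open>L\<close> grows faster
than \<open>ln n\<close>.\<close>
lemma partition_sum_le:
  assumes \<rho>: "\<rho> > 0" and \<beta>: "\<beta> \<ge> 0" and q: "q > 0" and n: "n \<ge> 1" and L: "L \<ge> 1"
    and B: "\<And>a. (\<And>i. i < n \<Longrightarrow> 0 \<le> a i \<and> a i \<le> real q) \<Longrightarrow>
      ln \<rho> * (\<Sum>i<n. a i) + \<beta> / (real n)\<^sup>2 * (\<Sum>j\<in>{1..<n}. (\<Sum>i\<in>{j..<n}. a i)\<^sup>2)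
        - real q * (\<Sum>i<n. I_fun (a i / real q)) \<le> B"
  shows "partition_sum \<rho> \<beta> q n \<le> real (q * n + 1) ^ (n div L + 1) * exp (B + 2 * \<beta> * (real q)\<^sup>2 * real L)"
proof -
  let ?K = "{..<n} \<rightarrow>\<^sub>E {..q}"
  have finK: "finite ?K" by (intro finite_PiE) auto
  define w where "w k = (\<Prod>i<n. real (q choose k i) * \<rho> ^ k i)
    * exp (\<beta> / (real n)\<^sup>2 * (\<Sum>j\<in>{1..<n}. (\<Sum>i\<in>{j..<n}. real (k i))\<^sup>2 - (\<Sum>i\<in>{j..<n}. real (k i))))" for k
  define E where "E = 2 * \<beta> * (real q)\<^sup>2 * real L"
  have cls: "(\<Sum>k\<in>{k \<in> ?K. block_avg L n k = a}. w k) \<le> exp (B + E)" if aK: "a \<in> block_avg L n ` ?K" for a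
  proof -
    have a: "0 \<le> a i \<and> a i \<le> real q" for i
    proof -
      obtain k where k: "k \<in> ?K" "a = block_avg L n k" using aK by auto
      then have "\<And>i. i < n \<Longrightarrow> k i \<le> q" by auto
      from block_avg_bounds[OF this] k(2) show ?thesis by simp
    qed
    define G where "G = ln \<rho> * (\<Sum>i<n. a i) + \<beta> / (real n)\<^sup>2 * (\<Sum>j\<in>{1..<n}. (\<Sum>i\<in>{j..<n}. a i)\<^sup>2) + E"
    have wk: "w k \<le> (\<Prod>i<n. real (q choose k i)) * exp G" if k: "k \<in> ?K" "block_avg L n k = a" for k
    proof -
      have kq: "k i \<le> q" if "i < n" for i using k that by auto
      define T where "T j = (\<Sum>i\<in>{j..<n}. real (k i))" for j
      define A where "A j = (\<Sum>i\<in>{j..<n}. a i)" for j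
      have tail: "\<bar>T j - A j\<bar> \<le> real q * real L" for j
        using block_avg_tail[OF L, of n k q j] kq k(2) by (simp add: T_def A_def)
      have card: "real (card {j..<n}) * real q \<le> real q * real n" for j
        by (subst mult.commute) (intro mult_left_mono, auto)
      have T: "0 \<le> T j" "T j \<le> real q * real n" for j
      proof -
        have "T j \<le> (\<Sum>i\<in>{j..<n}. real q)" unfolding T_def using kq by (intro sum_mono) auto
        also have "\<dots> \<le> real q * real n" using card[of j] by (simp only: sum_constant)
        finally show "T j \<le> real q * real n" .
      qed (simp add: T_def sum_nonneg)
      have A: "0 \<le> A j" "A j \<le> real q * real n" for j
      proof -
        have "A j \<le> (\<Sum>i\<in>{j..<n}. real q)" unfolding A_def using a by (intro sum_mono) auto
        also have "\<dots> \<le> real q * real n" using card[of j] by (simp only: sum_constant)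
        finally show "A j \<le> real q * real n" .
      qed (use a in \<open>auto simp: A_def intro!: sum_nonneg\<close>)
      have sq: "(T j)\<^sup>2 - T j \<le> (A j)\<^sup>2 + 2 * (real q)\<^sup>2 * real L * real n" for j
      proof -
        have "(T j)\<^sup>2 - (A j)\<^sup>2 = (T j - A j) * (T j + A j)" by (simp add: power2_eq_square algebra_simps)
        also have "\<dots> \<le> \<bar>T j - A j\<bar> * (T j + A j)" using T A by (intro mult_right_mono) auto
        also have "\<dots> \<le> (real q * real L) * (real q * real n + real q * real n)"
          using T[of j] A[of j] tail[of j] by (intro mult_mono add_mono) auto
        also have "\<dots> = 2 * (real q)\<^sup>2 * real L * real n" by (simp add: power2_eq_square)
        finally show ?thesis using T(1)[of j] by simp
      qed
      have "(\<Sum>j\<in>{1..<n}. (T j)\<^sup>2 - T j) \<le> (\<Sum>j\<in>{1..<n}. (A j)\<^sup>2 + 2 * (real q)\<^sup>2 * real L * real n)"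
        by (intro sum_mono sq)
      also have "\<dots> = (\<Sum>j\<in>{1..<n}. (A j)\<^sup>2) + real (n - 1) * (2 * (real q)\<^sup>2 * real L * real n)"
        by (simp add: sum.distrib)
      also have "\<dots> \<le> (\<Sum>j\<in>{1..<n}. (A j)\<^sup>2) + real n * (2 * (real q)\<^sup>2 * real L * real n)"
        by (intro add_left_mono mult_right_mono) auto
      finally have "\<beta> / (real n)\<^sup>2 * (\<Sum>j\<in>{1..<n}. (T j)\<^sup>2 - T j)
          \<le> \<beta> / (real n)\<^sup>2 * ((\<Sum>j\<in>{1..<n}. (A j)\<^sup>2) + real n * (2 * (real q)\<^sup>2 * real L * real n))"
        using \<beta> by (intro mult_left_mono) auto
      also have "\<dots> = \<beta> / (real n)\<^sup>2 * (\<Sum>j\<in>{1..<n}. (A j)\<^sup>2) + E"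
        using n by (simp add: E_def distrib_left power2_eq_square)
      finally have ex: "\<beta> / (real n)\<^sup>2 * (\<Sum>j\<in>{1..<n}. (T j)\<^sup>2 - T j) \<le> \<beta> / (real n)\<^sup>2 * (\<Sum>j\<in>{1..<n}. (A j)\<^sup>2) + E" .
      have "(\<Prod>i<n. \<rho> ^ k i) = exp (ln \<rho> * (\<Sum>i<n. real (k i)))"
      proof -
        have "\<rho> ^ k i = exp (ln \<rho> * real (k i))" for i
          using \<rho> by (simp add: mult.commute[of "ln \<rho>"] exp_of_nat_mult)
        then show ?thesis by (simp add: exp_sum sum_distrib_left)
      qed
      also have "(\<Sum>i<n. real (k i)) = (\<Sum>i<n. a i)"
        using sum_block_avg[of L n k "\<lambda>_. 1"] k by simp
      finally have rho: "(\<Prod>i<n. \<rho> ^ k i) = exp (ln \<rho> * (\<Sum>i<n. a i))" .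
      have "w k = (\<Prod>i<n. real (q choose k i)) * (exp (ln \<rho> * (\<Sum>i<n. a i)) * exp (\<beta> / (real n)\<^sup>2 * (\<Sum>j\<in>{1..<n}. (T j)\<^sup>2 - T j)))"
        unfolding w_def T_def prod.distrib rho by simp
      also have "\<dots> \<le> (\<Prod>i<n. real (q choose k i)) * exp G"
        unfolding exp_add[symmetric] using ex by (intro mult_left_mono prod_nonneg) (auto simp: G_def A_def)
      finally show ?thesis .
    qed
    have "(\<Sum>k\<in>{k \<in> ?K. block_avg L n k = a}. w k)
        \<le> (\<Sum>k\<in>{k \<in> ?K. block_avg L n k = a}. \<Prod>i<n. real (q choose k i)) * exp G"
      unfolding sum_distrib_right by (intro sum_mono wk) auto
    also have "\<dots> \<le> exp (- real q * (\<Sum>i<n. I_fun (a i / real q))) * exp G"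
      by (intro mult_right_mono block_class_weight_le[OF q L] a) auto
    also have "\<dots> \<le> exp (B + E)"
      unfolding exp_add[symmetric] using B[of a] a by (simp add: G_def)
    finally show ?thesis .
  qed
  have "partition_sum \<rho> \<beta> q n = (\<Sum>k\<in>?K. w k)" by (simp add: partition_sum_def w_def)
  also have "\<dots> = (\<Sum>a\<in>block_avg L n ` ?K. \<Sum>k\<in>{k \<in> ?K. block_avg L n k = a}. w k)"
    by (rule sum.image_gen[OF finK])
  also have "\<dots> \<le> (\<Sum>a\<in>block_avg L n ` ?K. exp (B + E))" by (intro sum_mono cls)
  also have "\<dots> = real (card (block_avg L n ` ?K)) * exp (B + E)" by simp
  also have "\<dots> \<le> real ((q * n + 1) ^ (n div L + 1)) * exp (B + E)"
    by (intro mult_right_mono of_nat_mono card_block_avg_le) auto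
  finally show ?thesis by (simp only: E_def of_nat_power)
qed

section \<open>The growth rate of the partition function\<close>

lemma variational_value_eq_Sup:
  "variational_value \<rho> \<beta> q = (SUP g\<in>admissible q. rate_functional \<rho> \<beta> q g)"
  by (simp add: variational_value_def rate_functional_def)

text \<open>Any block length \<open>L\<close> that grows faster than \<open>ln n\<close> and slower than \<open>n\<close> works, such as \<open>sqrt n\<close>: the
logarithm of the number of classes, about \<open>(n / L) * ln n\<close>, and the energy error, of order \<open>L\<close>,
are then both \<open>o(n)\<close>.\<close>
lemma partition_sum_rate_le:
  assumes \<rho>: "\<rho> > 0" and \<beta>: "\<beta> \<ge> 0" and q: "q > 0" and n: "n \<ge> 1"
  shows "1 / real n * ln (partition_sum \<rho> \<beta> q n) \<le> variational_value \<rho> \<beta> q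
    + ((sqrt (real n) + 1) * ln (real q * real n + 1) + 2 * \<beta> * (real q)\<^sup>2 * (sqrt (real n) + 1)) / real n"
proof -
  define V where "V = variational_value \<rho> \<beta> q"
  define L where "L = nat \<lceil>sqrt (real n)\<rceil>"
  have sq: "sqrt (real n) \<ge> 1" using n by simp
  have "sqrt (real n) \<le> real L" unfolding L_def by (rule real_nat_ceiling_ge)
  moreover have "real L = real_of_int \<lceil>sqrt (real n)\<rceil>" unfolding L_def by simp
  ultimately have L: "L \<ge> 1" "sqrt (real n) \<le> real L" "real L \<le> sqrt (real n) + 1"
    using sq by linarith+
  have "ln \<rho> * (\<Sum>i<n. a i) + \<beta> / (real n)\<^sup>2 * (\<Sum>j\<in>{1..<n}. (\<Sum>i\<in>{j..<n}. a i)\<^sup>2)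
        - real q * (\<Sum>i<n. I_fun (a i / real q)) \<le> real n * V"
    if a: "\<And>i. i < n \<Longrightarrow> 0 \<le> a i \<and> a i \<le> real q" for a
  proof -
    have "rate_functional \<rho> \<beta> q (polygon n a) \<le> V"
      unfolding V_def variational_value_eq_Sup
      by (rule cSUP_upper[OF polygon_admissible[OF n a] bdd_above_rate_functional[OF \<rho> \<beta> q]])
    moreover note rate_functional_polygon_ge[OF \<beta> n, of a q \<rho>]
    ultimately have "1 / real n * (ln \<rho> * (\<Sum>i<n. a i) + \<beta> / (real n)\<^sup>2 * (\<Sum>j\<in>{1..<n}. (\<Sum>i\<in>{j..<n}. a i)\<^sup>2)
        - real q * (\<Sum>i<n. I_fun (a i / real q))) \<le> V"
      using a order_trans by blast
    from mult_left_mono[OF this, of "real n"] n show ?thesis by simp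
  qed
  from partition_sum_le[OF \<rho> \<beta> q n L(1) this]
  have "ln (partition_sum \<rho> \<beta> q n)
      \<le> ln (real (q * n + 1) ^ (n div L + 1) * exp (real n * V + 2 * \<beta> * (real q)\<^sup>2 * real L))"
    using partition_sum_pos[OF \<rho>, of \<beta> q n] by (subst ln_le_cancel_iff) auto
  also have "\<dots> = real (n div L + 1) * ln (real q * real n + 1) + (real n * V + 2 * \<beta> * (real q)\<^sup>2 * real L)"
  proof -
    have ln_power_exp: "ln (c ^ k * exp y) = real k * ln c + y" if "c > 0" for c y :: real and k
      using that by (subst ln_mult_pos) (auto simp: ln_realpow)
    have "real q * real n + 1 > 0" by (intro add_nonneg_pos) auto
    moreover have "real (q * n + 1) = real q * real n + 1" by simp
    ultimately show ?thesis by (simp only: ln_power_exp)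
  qed
  also have "\<dots> \<le> (sqrt (real n) + 1) * ln (real q * real n + 1) + (real n * V + 2 * \<beta> * (real q)\<^sup>2 * (sqrt (real n) + 1))"
  proof -
    have "real (n div L) \<le> real n / real L" by (rule of_nat_div_le_of_nat)
    also have "\<dots> \<le> real n / sqrt (real n)" by (intro divide_left_mono mult_pos_pos; use L sq in linarith)
    also have "\<dots> = sqrt (real n)" by (rule real_div_sqrt) simp
    finally have "real (n div L + 1) * ln (real q * real n + 1) \<le> (sqrt (real n) + 1) * ln (real q * real n + 1)"
      by (intro mult_right_mono) auto
    moreover have "2 * \<beta> * (real q)\<^sup>2 * real L \<le> 2 * \<beta> * (real q)\<^sup>2 * (sqrt (real n) + 1)"
      using L \<beta> by (intro mult_left_mono) auto
    ultimately show ?thesis by linarith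
  qed
  finally have "1 / real n * ln (partition_sum \<rho> \<beta> q n) \<le> 1 / real n *
      ((sqrt (real n) + 1) * ln (real q * real n + 1) + (real n * V + 2 * \<beta> * (real q)\<^sup>2 * (sqrt (real n) + 1)))"
    by (intro mult_left_mono) auto
  also have "\<dots> = V + ((sqrt (real n) + 1) * ln (real q * real n + 1) + 2 * \<beta> * (real q)\<^sup>2 * (sqrt (real n) + 1)) / real n"
    using n by (simp add: field_simps)
  finally show ?thesis by (simp add: V_def)
qed

lemma variational_value_le:
  assumes "\<rho> > 0" "\<beta> \<ge> 0" "q > 0" "n \<ge> 1"
  shows "variational_value \<rho> \<beta> q \<le> 1 / real n * ln (partition_sum \<rho> \<beta> q n) + (\<beta> * real q + \<beta> * (real q)\<^sup>2) / real n"
  unfolding variational_value_eq_Sup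
proof (rule cSUP_least)
  have "polygon 1 (\<lambda>_. 0) \<in> admissible q" by (rule polygon_admissible) auto
  then show "admissible q \<noteq> {}" by auto
qed (rule rate_functional_le[OF assms])

lemma partition_sum_rate_tendsto:
  assumes "\<rho> > 0" "\<beta> \<ge> 0" "q > 0"
  shows "(\<lambda>n. 1 / real n * ln (partition_sum \<rho> \<beta> q n)) \<longlonglongrightarrow> variational_value \<rho> \<beta> q"
proof (rule tendsto_sandwich)
  show "\<forall>\<^sub>F n in sequentially. variational_value \<rho> \<beta> q - (\<beta> * real q + \<beta> * (real q)\<^sup>2) / real n
      \<le> 1 / real n * ln (partition_sum \<rho> \<beta> q n)"
    using eventually_ge_at_top[of 1]
  proof eventually_elim
    case (elim n)
    from variational_value_le[OF assms elim] show ?case by linarith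
  qed
  show "\<forall>\<^sub>F n in sequentially. 1 / real n * ln (partition_sum \<rho> \<beta> q n) \<le> variational_value \<rho> \<beta> q
      + ((sqrt (real n) + 1) * ln (real q * real n + 1) + 2 * \<beta> * (real q)\<^sup>2 * (sqrt (real n) + 1)) / real n"
    using eventually_ge_at_top[of 1] by eventually_elim (rule partition_sum_rate_le[OF assms])
  have "(\<lambda>n. (\<beta> * real q + \<beta> * (real q)\<^sup>2) / real n) \<longlonglongrightarrow> 0"
    by real_asymp
  from tendsto_diff[OF tendsto_const this]
  show "(\<lambda>n. variational_value \<rho> \<beta> q - (\<beta> * real q + \<beta> * (real q)\<^sup>2) / real n) \<longlonglongrightarrow> variational_value \<rho> \<beta> q"
    by simp
  have lim: "(\<lambda>n. ((sqrt (real n) + 1) * ln (c * real n + 1) + d * (sqrt (real n) + 1)) / real n) \<longlonglongrightarrow> 0"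
    if "c > 0" for c d :: real
    using that by real_asymp
  from tendsto_add[OF tendsto_const lim]
  show "(\<lambda>n. variational_value \<rho> \<beta> q + ((sqrt (real n) + 1) * ln (real q * real n + 1)
      + 2 * \<beta> * (real q)\<^sup>2 * (sqrt (real n) + 1)) / real n) \<longlonglongrightarrow> variational_value \<rho> \<beta> q"
    using assms(3) by simp
qed

section \<open>The inhomogeneous recursion\<close>

text \<open>As all \<open>a i \<ge> 1\<close>, the perturbation \<open>b i\<close> grows by at most the full product of the coefficients.\<close>
lemma lin_rec_bounds:
  assumes "\<And>i. i < n \<Longrightarrow> a i \<ge> 1" "\<And>i. i < n \<Longrightarrow> b i \<ge> 0" "x0 \<ge> 0"
  shows "x0 * (\<Prod>i<n. a i) \<le> lin_rec a b x0 n"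
    and "lin_rec a b x0 n \<le> (\<Prod>i<n. a i) * (x0 + (\<Sum>i<n. b i))"
proof -
  have "x0 * (\<Prod>i<n. a i) \<le> lin_rec a b x0 n \<and> lin_rec a b x0 n \<le> (\<Prod>i<n. a i) * (x0 + (\<Sum>i<n. b i))"
    using assms
  proof (induction n)
    case (Suc n)
    define P where "P = (\<Prod>i<n. a i)"
    define X where "X = lin_rec a b x0 n"
    define S where "S = x0 + (\<Sum>i<n. b i)"
    have IH: "x0 * P \<le> X" "X \<le> P * S" using Suc by (auto simp: P_def X_def S_def)
    have an: "a n \<ge> 1" and bn: "b n \<ge> 0" using Suc.prems by auto
    have "P \<ge> 1" unfolding P_def by (intro prod_ge_1) (use Suc.prems in auto)
    with an have "1 * 1 \<le> P * a n" by (intro mult_mono) auto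
    then have "1 * b n \<le> P * a n * b n" using bn by (intro mult_right_mono) auto
    moreover have "a n * (x0 * P) \<le> a n * X" "a n * X \<le> a n * (P * S)"
      using IH an by (auto intro!: mult_left_mono)
    ultimately have "x0 * (P * a n) \<le> a n * X + b n \<and> a n * X + b n \<le> P * a n * (S + b n)"
      using bn by (simp add: algebra_simps)
    then show ?case by (simp add: P_def X_def S_def add.assoc)
  qed simp
  then show "x0 * (\<Prod>i<n. a i) \<le> lin_rec a b x0 n" "lin_rec a b x0 n \<le> (\<Prod>i<n. a i) * (x0 + (\<Sum>i<n. b i))"
    by auto
qed

text \<open>All \<open>n + 1\<close> summands are at most their maximum, whose \<open>q\<close>-th power is one of the terms on the right.\<close>
lemma power_add_sum_le:
  fixes x0 :: real
  assumes "x0 \<ge> 0" "\<And>i. i < n \<Longrightarrow> b i \<ge> 0"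
  shows "(x0 + (\<Sum>i<n. b i)) ^ q \<le> (real n + 1) ^ q * (x0 ^ q + (\<Sum>i<n. b i ^ q))"
proof -
  define y where "y = Max (insert x0 (b ` {..<n}))"
  have y: "x0 \<le> y" "\<And>i. i < n \<Longrightarrow> b i \<le> y" unfolding y_def by (auto intro!: Max_ge)
  have "y \<in> insert x0 (b ` {..<n})" unfolding y_def by (intro Max_in) auto
  then have yq: "y ^ q \<le> x0 ^ q + (\<Sum>i<n. b i ^ q)"
  proof
    assume "y \<in> b ` {..<n}"
    then obtain i where i: "i < n" "y = b i" by auto
    then have "b i ^ q \<le> (\<Sum>i<n. b i ^ q)" using assms(2) by (intro member_le_sum) auto
    with i assms(1) show ?thesis by (simp add: add_increasing)
  qed (use assms in \<open>auto intro!: sum_nonneg\<close>)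
  have "x0 + (\<Sum>i<n. b i) \<le> y + (\<Sum>i<n. y)" using y by (intro add_mono sum_mono) auto
  then have "(x0 + (\<Sum>i<n. b i)) ^ q \<le> ((real n + 1) * y) ^ q"
    using assms by (intro power_mono add_nonneg_nonneg sum_nonneg) (auto simp: algebra_simps)
  also have "\<dots> \<le> (real n + 1) ^ q * (x0 ^ q + (\<Sum>i<n. b i ^ q))"
    using yq by (simp add: power_mult_distrib mult_left_mono)
  finally show ?thesis .
qed

lemma mult_coeff_ge_1: "\<rho> > 0 \<Longrightarrow> mult_coeff W \<rho> \<sigma> \<tau> i \<omega> \<ge> 1"
  by (simp add: mult_coeff_def)

text \<open>Independence factorises the moment of \<open>(\<Prod>i<n. a i) * (x0 + (\<Sum>i<n. b i))\<close>, so the additive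
noise costs only a factor that is polynomial in \<open>n\<close>. The upper bound in the pointwise estimate also
gives integrability, without which the integral in the statement would be \<open>0\<close> by convention.\<close>
lemma inhomogeneous_moment_bounds:
  fixes M :: "'a measure" and b :: "nat \<Rightarrow> 'a \<Rightarrow> real"
  assumes BM: "brownian_motion M W" and \<rho>: "\<rho> > 0" and \<tau>: "\<tau> > 0" and x0: "x0 > 0" and n: "n \<ge> 1"
    and scale: "1/2 * \<sigma>\<^sup>2 * \<tau> * (real n)\<^sup>2 = \<beta>"
    and b_meas: "\<And>i. b i \<in> borel_measurable M"
    and b_distr: "\<And>i. distr M borel (b i) = distr M borel (b 0)"
    and b_pos: "\<And>i. AE \<omega> in M. b i \<omega> > 0"
    and indep: "prob_space.indep_var M
             (Pi\<^sub>M UNIV (\<lambda>_. borel)) (\<lambda>\<omega> i. mult_coeff W \<rho> \<sigma> \<tau> i \<omega>)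
             (Pi\<^sub>M UNIV (\<lambda>_. borel)) (\<lambda>\<omega> i. b i \<omega>)"
    and b_int: "integrable M (\<lambda>\<omega>. b 0 \<omega> ^ q)"
  shows "x0 ^ q * partition_sum \<rho> \<beta> q n
      \<le> (\<integral>\<omega>. lin_rec (\<lambda>i. mult_coeff W \<rho> \<sigma> \<tau> i \<omega>) (\<lambda>i. b i \<omega>) x0 n ^ q \<partial>M)"
    and "(\<integral>\<omega>. lin_rec (\<lambda>i. mult_coeff W \<rho> \<sigma> \<tau> i \<omega>) (\<lambda>i. b i \<omega>) x0 n ^ q \<partial>M)
      \<le> partition_sum \<rho> \<beta> q n * ((real n + 1) ^ q * (x0 ^ q + real n * (\<integral>\<omega>. b 0 \<omega> ^ q \<partial>M)))"
proof -
  interpret prob_space M using BM by (simp add: brownian_motion_def)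
  define a where "a i \<omega> = mult_coeff W \<rho> \<sigma> \<tau> i \<omega>" for i \<omega>
  define X where "X \<omega> = lin_rec (\<lambda>i. a i \<omega>) (\<lambda>i. b i \<omega>) x0 n" for \<omega>
  define P where "P \<omega> = (\<Prod>i<n. a i \<omega>) ^ q" for \<omega>
  define R where "R \<omega> = (real n + 1) ^ q * (x0 ^ q + (\<Sum>i<n. b i \<omega> ^ q))" for \<omega>
  have W_meas: "W (real i * \<tau>) \<in> borel_measurable M" for i
    using BM \<tau> by (simp add: brownian_motion_def)
  have a_meas: "a i \<in> borel_measurable M" for i
    unfolding a_def[abs_def] mult_coeff_def[abs_def]
    by (intro borel_measurable_add borel_measurable_times borel_measurable_const
        measurable_compose[OF _ borel_measurable_exp] borel_measurable_diff W_meas)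
  note [measurable] = a_meas b_meas
  have a1: "a i \<omega> \<ge> 1" for i \<omega> unfolding a_def using \<rho> by (rule mult_coeff_ge_1)
  have lin_meas: "(\<lambda>\<omega>. lin_rec (\<lambda>i. a i \<omega>) (\<lambda>i. b i \<omega>) x0 m) \<in> borel_measurable M" for m
    by (induction m) auto
  have X_meas[measurable]: "X \<in> borel_measurable M"
    unfolding X_def[abs_def] by (rule lin_meas)
  have P: "integrable M P" "expectation P = partition_sum \<rho> \<beta> q n"
    unfolding P_def[abs_def] a_def using moment_prod_mult_coeff[OF BM \<tau> n scale] by auto
  have b_moment: "integrable M (\<lambda>\<omega>. b i \<omega> ^ q) \<and> expectation (\<lambda>\<omega>. b i \<omega> ^ q) = expectation (\<lambda>\<omega>. b 0 \<omega> ^ q)" for i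
  proof -
    have "integrable (distr M borel (b 0)) (\<lambda>x. x ^ q)"
      using b_int by (subst integrable_distr_eq) auto
    then have "integrable (distr M borel (b i)) (\<lambda>x. x ^ q)" by (simp only: b_distr[of i])
    then have "integrable M (\<lambda>\<omega>. b i \<omega> ^ q)" by (subst (asm) integrable_distr_eq) auto
    moreover have "expectation (\<lambda>\<omega>. b j \<omega> ^ q) = integral\<^sup>L (distr M borel (b j)) (\<lambda>x. x ^ q)" for j
      by (subst integral_distr) auto
    ultimately show ?thesis using b_distr[of i] by simp
  qed
  have R: "integrable M R" "expectation R = (real n + 1) ^ q * (x0 ^ q + real n * expectation (\<lambda>\<omega>. b 0 \<omega> ^ q))"
  proof -
    define m where "m = expectation (\<lambda>\<omega>. b 0 \<omega> ^ q)"
    have b: "integrable M (\<lambda>\<omega>. b i \<omega> ^ q)" "expectation (\<lambda>\<omega>. b i \<omega> ^ q) = m" for i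
      using b_moment[of i] by (auto simp: m_def)
    then show "integrable M R" unfolding R_def[abs_def] by auto
    show "expectation R = (real n + 1) ^ q * (x0 ^ q + real n * expectation (\<lambda>\<omega>. b 0 \<omega> ^ q))"
      unfolding R_def[abs_def] m_def[symmetric] using b by (simp add: prob_space)
  qed
  have "indep_var borel ((\<lambda>f. (\<Prod>i<n. f i) ^ q) \<circ> (\<lambda>\<omega> i. mult_coeff W \<rho> \<sigma> \<tau> i \<omega>))
          borel ((\<lambda>f. (real n + 1) ^ q * (x0 ^ q + (\<Sum>i<n. f i ^ q))) \<circ> (\<lambda>\<omega> i. b i \<omega>))"
    by (rule indep_var_compose[OF indep]) measurable
  then have ind: "indep_var borel P borel R"
    by (simp add: comp_def P_def[abs_def] R_def[abs_def] a_def)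
  have PR: "integrable M (\<lambda>\<omega>. P \<omega> * R \<omega>)" "expectation (\<lambda>\<omega>. P \<omega> * R \<omega>) = expectation P * expectation R"
    using indep_var_integrable[OF ind P(1) R(1)] indep_var_lebesgue_integral[OF ind P(1) R(1)] by auto
  have b_all: "AE \<omega> in M. \<forall>i. b i \<omega> > 0"
    using b_pos by (simp add: AE_all_countable)
  have bounds: "AE \<omega> in M. x0 ^ q * P \<omega> \<le> X \<omega> ^ q \<and> X \<omega> ^ q \<le> P \<omega> * R \<omega>"
    using b_all
  proof eventually_elim
    case (elim \<omega>)
    define A where "A = (\<Prod>i<n. a i \<omega>)"
    have A: "A \<ge> 0" unfolding A_def using a1 by (intro prod_nonneg) (auto intro: order_trans[of 0 1])
    have l: "x0 * A \<le> X \<omega>" "X \<omega> \<le> A * (x0 + (\<Sum>i<n. b i \<omega>))"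
      using lin_rec_bounds[of n "\<lambda>i. a i \<omega>" "\<lambda>i. b i \<omega>" x0] a1 elim x0 by (auto simp: A_def X_def less_imp_le)
    have "(x0 * A) ^ q \<le> X \<omega> ^ q" using l A x0 by (intro power_mono) auto
    moreover have "X \<omega> ^ q \<le> (A * (x0 + (\<Sum>i<n. b i \<omega>))) ^ q"
      using l A x0 by (intro power_mono) (auto intro: order_trans[of 0 "x0 * A"])
    moreover have "A ^ q * (x0 + (\<Sum>i<n. b i \<omega>)) ^ q \<le> A ^ q * R \<omega>"
      unfolding R_def using elim x0 A by (intro mult_left_mono power_add_sum_le) (auto simp: less_imp_le)
    ultimately show ?case by (simp add: P_def A_def[symmetric] power_mult_distrib)
  qed
  have x0P: "0 \<le> x0 ^ q * P \<omega>" for \<omega>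
  proof -
    have "0 \<le> a i \<omega>" for i by (rule order_trans[OF zero_le_one a1])
    then show ?thesis using x0 by (simp add: P_def prod_nonneg)
  qed
  have X_int: "integrable M (\<lambda>\<omega>. X \<omega> ^ q)"
  proof (rule Bochner_Integration.integrable_bound[OF PR(1)])
    show "AE \<omega> in M. norm (X \<omega> ^ q) \<le> norm (P \<omega> * R \<omega>)"
      using bounds
    proof eventually_elim
      case (elim \<omega>)
      with x0P[of \<omega>] show ?case by simp
    qed
  qed measurable
  have "expectation (\<lambda>\<omega>. x0 ^ q * P \<omega>) \<le> expectation (\<lambda>\<omega>. X \<omega> ^ q)"
    by (rule integral_mono_AE[OF _ X_int]) (use bounds P(1) in auto)
  then show "x0 ^ q * partition_sum \<rho> \<beta> q n
      \<le> (\<integral>\<omega>. lin_rec (\<lambda>i. mult_coeff W \<rho> \<sigma> \<tau> i \<omega>) (\<lambda>i. b i \<omega>) x0 n ^ q \<partial>M)"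
    using P by (simp add: X_def a_def)
  have "expectation (\<lambda>\<omega>. X \<omega> ^ q) \<le> expectation (\<lambda>\<omega>. P \<omega> * R \<omega>)"
    by (rule integral_mono_AE[OF X_int PR(1)]) (use bounds in auto)
  then show "(\<integral>\<omega>. lin_rec (\<lambda>i. mult_coeff W \<rho> \<sigma> \<tau> i \<omega>) (\<lambda>i. b i \<omega>) x0 n ^ q \<partial>M)
      \<le> partition_sum \<rho> \<beta> q n * ((real n + 1) ^ q * (x0 ^ q + real n * (\<integral>\<omega>. b 0 \<omega> ^ q \<partial>M)))"
    by (simp add: PR P R X_def a_def)
qed

theorem theorem27:
  fixes M :: "'a measure"
    and W :: "real \<Rightarrow> 'a \<Rightarrow> real"
    and b :: "nat \<Rightarrow> 'a \<Rightarrow> real"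
    and \<sigma> \<tau> :: "nat \<Rightarrow> real"
    and \<rho> \<beta> x0 :: real
    and q :: nat
  assumes "prob_space M"
    and "\<rho> > 0" and "\<beta> > 0" and "x0 > 0" and "q > 0"
    and "\<And>n. n \<ge> 1 \<Longrightarrow> \<sigma> n > 0"
    and "\<And>n. n \<ge> 1 \<Longrightarrow> \<tau> n > 0"
    and "\<And>n. n \<ge> 1 \<Longrightarrow> 1/2 * (\<sigma> n)\<^sup>2 * \<tau> n * (real n)\<^sup>2 = \<beta>"
    and "brownian_motion M W"
    and "prob_space.indep_vars M (\<lambda>_. borel) b UNIV"
    and "\<And>i. distr M borel (b i) = distr M borel (b 0)"
    and "\<And>i. AE \<omega> in M. b i \<omega> > 0"
    and "\<And>n. n \<ge> 1 \<Longrightarrow>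
           prob_space.indep_var M
             (Pi\<^sub>M UNIV (\<lambda>_. borel)) (\<lambda>\<omega> i. mult_coeff W \<rho> (\<sigma> n) (\<tau> n) i \<omega>)
             (Pi\<^sub>M UNIV (\<lambda>_. borel)) (\<lambda>\<omega> i. b i \<omega>)"
    and "integrable M (\<lambda>\<omega>. b 0 \<omega> ^ q)"
  shows "convergent (hom_log_moment_rate M W \<sigma> \<tau> \<rho> x0 q) \<and>
         lyapunov_exponent M W \<sigma> \<tau> \<rho> x0 q = variational_value \<rho> \<beta> q \<and>
         log_moment_rate M W b \<sigma> \<tau> \<rho> x0 q \<longlonglongrightarrow> lyapunov_exponent M W \<sigma> \<tau> \<rho> x0 q"
proof -
  interpret prob_space M by fact
  note \<rho> = \<open>\<rho> > 0\<close> and x0 = \<open>x0 > 0\<close>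
  define V where "V = variational_value \<rho> \<beta> q"
  define Z where "Z n = partition_sum \<rho> \<beta> q n" for n
  define m where "m = (\<integral>\<omega>. b 0 \<omega> ^ q \<partial>M)"
  have Z_pos: "Z n > 0" for n unfolding Z_def using \<rho> by (rule partition_sum_pos)
  have Z_lim: "(\<lambda>n. 1 / real n * ln (Z n)) \<longlonglongrightarrow> V"
    unfolding Z_def V_def using assms by (intro partition_sum_rate_tendsto) auto
  have b_meas: "b i \<in> borel_measurable M" for i
    using assms(10) by (auto simp: indep_vars_def)
  have m: "m \<ge> 0"
    unfolding m_def using assms(12)[of 0] by (intro integral_nonneg_AE) (auto elim: eventually_mono)
  have hom_eq: "hom_log_moment_rate M W \<sigma> \<tau> \<rho> x0 q n = 1 / real n * ln (x0 ^ q) + 1 / real n * ln (Z n)"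
    if n: "n \<ge> 1" for n
  proof -
    note mom = moment_prod_mult_coeff[OF assms(9) assms(7)[OF n] n assms(8)[OF n], of \<rho> q]
    have "hom_log_moment_rate M W \<sigma> \<tau> \<rho> x0 q n = 1 / real n * ln (x0 ^ q * Z n)"
      unfolding hom_log_moment_rate_def power_mult_distrib using mom by (simp add: Z_def)
    also have "ln (x0 ^ q * Z n) = ln (x0 ^ q) + ln (Z n)" using Z_pos x0 by (intro ln_mult_pos) auto
    finally show ?thesis by (simp only: distrib_left)
  qed
  have "(\<lambda>n. 1 / real n * ln (x0 ^ q)) \<longlonglongrightarrow> 0" by real_asymp
  from tendsto_add[OF this Z_lim] have low: "(\<lambda>n. 1 / real n * ln (x0 ^ q) + 1 / real n * ln (Z n)) \<longlonglongrightarrow> V"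
    by simp
  have hom: "hom_log_moment_rate M W \<sigma> \<tau> \<rho> x0 q \<longlonglongrightarrow> V"
  proof (rule Lim_transform_eventually[OF low])
    show "\<forall>\<^sub>F n in sequentially. 1 / real n * ln (x0 ^ q) + 1 / real n * ln (Z n) = hom_log_moment_rate M W \<sigma> \<tau> \<rho> x0 q n"
      using eventually_ge_at_top[of 1] by eventually_elim (simp only: hom_eq)
  qed
  then have conv: "convergent (hom_log_moment_rate M W \<sigma> \<tau> \<rho> x0 q)" by (rule convergentI)
  have lyap: "lyapunov_exponent M W \<sigma> \<tau> \<rho> x0 q = V"
    unfolding lyapunov_exponent_def using hom by (rule limI)
  \<comment> \<open>The polynomial price of the additive noise, on the logarithmic scale.\<close>
  define u where "u n = 1 / real n * ln ((real n + 1) ^ q * (x0 ^ q + real n * m))" for n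
  have sq: "1 / real n * ln (x0 ^ q) + 1 / real n * ln (Z n) \<le> log_moment_rate M W b \<sigma> \<tau> \<rho> x0 q n \<and>
      log_moment_rate M W b \<sigma> \<tau> \<rho> x0 q n \<le> u n + 1 / real n * ln (Z n)" if n: "n \<ge> 1" for n
  proof -
    define E where "E = (\<integral>\<omega>. lin_rec (\<lambda>i. mult_coeff W \<rho> (\<sigma> n) (\<tau> n) i \<omega>) (\<lambda>i. b i \<omega>) x0 n ^ q \<partial>M)"
    note B = inhomogeneous_moment_bounds[OF assms(9) \<rho> assms(7)[OF n] x0 n assms(8)[OF n] b_meas assms(11)
        assms(12) assms(13)[OF n] assms(14), folded E_def m_def Z_def]
    have xZ: "x0 ^ q * Z n > 0" using x0 Z_pos by simp
    then have E: "E > 0" using B(1) by linarith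
    have c: "(real n + 1) ^ q * (x0 ^ q + real n * m) > 0"
      using x0 m by (intro mult_pos_pos add_pos_nonneg) auto
    have "ln (x0 ^ q) + ln (Z n) = ln (x0 ^ q * Z n)" using Z_pos x0 by (intro ln_mult_pos[symmetric]) auto
    also have "\<dots> \<le> ln E" using B(1) xZ E by simp
    finally have 1: "ln (x0 ^ q) + ln (Z n) \<le> ln E" .
    have "ln E \<le> ln (Z n * ((real n + 1) ^ q * (x0 ^ q + real n * m)))" using B(2) E by simp
    also have "\<dots> = ln ((real n + 1) ^ q * (x0 ^ q + real n * m)) + ln (Z n)"
      using Z_pos c by (subst ln_mult_pos) (auto simp: add.commute)
    finally have 2: "ln E \<le> ln ((real n + 1) ^ q * (x0 ^ q + real n * m)) + ln (Z n)" .
    show ?thesis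
      unfolding log_moment_rate_def E_def[symmetric] u_def distrib_left[symmetric]
      using 1 2 by (intro conjI mult_left_mono) auto
  qed
  have u0: "u \<longlonglongrightarrow> 0"
  proof -
    have "(\<lambda>n. 1 / real n * (real q * ln (real n + 1) + ln (c + real n * m))) \<longlonglongrightarrow> 0" if "c > 0" for c :: real
    proof (cases "m = 0")
      case True
      then show ?thesis by simp real_asymp
    next
      case False
      with m have "m > 0" by simp
      then show ?thesis using that by real_asymp
    qed
    from this[of "x0 ^ q"] have "(\<lambda>n. 1 / real n * (real q * ln (real n + 1) + ln (x0 ^ q + real n * m))) \<longlonglongrightarrow> 0"
      using x0 by simp
    moreover have "u = (\<lambda>n. 1 / real n * (real q * ln (real n + 1) + ln (x0 ^ q + real n * m)))"
    proof
      fix n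
      have "x0 ^ q + real n * m > 0" using x0 m by (intro add_pos_nonneg) auto
      then show "u n = 1 / real n * (real q * ln (real n + 1) + ln (x0 ^ q + real n * m))"
        unfolding u_def by (subst ln_mult_pos) (auto simp: ln_realpow)
    qed
    ultimately show ?thesis by simp
  qed
  from tendsto_add[OF u0 Z_lim] have up: "(\<lambda>n. u n + 1 / real n * ln (Z n)) \<longlonglongrightarrow> V" by simp
  have "log_moment_rate M W b \<sigma> \<tau> \<rho> x0 q \<longlonglongrightarrow> V"
    by (rule tendsto_sandwich[OF _ _ low up])
      (use eventually_ge_at_top[of 1] in \<open>eventually_elim, use sq in blast\<close>)+
  with conv lyap show ?thesis by (simp add: V_def)
qed

end
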